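(* Fix a slow time index $s$ and assume that the probing signal is even in time, i.e. $J_s(\boldsymbol{x},-t)=J_s(\boldsymbol{x},t)$ for all $t$. Let $u_{s,m}(\boldsymbol{x})=u_s(\boldsymbol{x},m\tau+T)$, $0\le m\le M-1$, be the snapshots of the first component of the wave, and let $\mathbb{G}_s\in\mathbb{R}^{M\times M}$ be their Gramian matrix, with entries $$(\mathbb{G}_s)_{m,j}=\langle u_{s,m},u_{s,j}\rangle,\qquad 0\le m,j\le M-1.$$ Then $\mathbb{G}_s$ is a symmetric matrix with Toeplitz plus Hankel structure (that is, it is the sum of a Toeplitz matrix and a Hankel matrix). Its entries on and above the diagonal are $$(\mathbb{G}_s)_{m,m+j}=\frac12\big[D_s(j\tau)+D_s(-j\tau)\big]+\frac12 D_s\big(2T+(2m+j)\tau\big),$$ for $0\le m\le M-1$ and $0\le j\le M-1-m$, and the entries below the diagonal are obtained from symmetry.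
   Context: Medium. The plane has coordinates $\boldsymbol{x}=(x,y)\in\mathbb{R}^2$. The magnetic permeability $\mu>0$ is constant; the dielectric permittivity $\varepsilon(\boldsymbol{x})>0$ is variable and equals a constant $\varepsilon_o>0$ outside a compact imaging domain $\Omega_{\rm im}\subset\mathbb{R}^2$; in particular $\varepsilon=\varepsilon_o$ near the antenna, which lies at positive distance from $\Omega_{\rm im}$. The wave speed is $c(\boldsymbol{x})=1/\sqrt{\mu\varepsilon(\boldsymbol{x})}$, and $c_o=1/\sqrt{\mu\varepsilon_o}$. Wave. For each slow time $s$, the scalar $u_s(\boldsymbol{x},t)$ and the two-component field $\boldsymbol{H}_s(\boldsymbol{x},t)$ (all real valued) solve $$(\partial_t+\mathcal{L})\begin{pmatrix}u_s\\ \boldsymbol{H}_s\end{pmatrix}=\begin{pmatrix}J_s\\ \boldsymbol{0}\end{pmatrix},\qquad \mathcal{L}=\begin{pmatrix}0&c(\boldsymbol{x})\partial_y&-c(\boldsymbol{x})\partial_x\\ \partial_y[c(\boldsymbol{x})\,\cdot\,]&0&0\\ -\partial_x[c(\boldsymbol{x})\,\cdot\,]&0&0\end{pmatrix},$$ in $\mathbb{R}^2\times\mathbb{R}$, with $u_s$ and $\boldsymbol{H}_s$ equal to zero at times preceding the temporal support of $J_s$. The operator $\mathcal{L}$ is skew-adjoint. The waves propagate with finite speed, so that over bounded times all fields have compact support in space, and the fields are assumed sufficiently regular. Source. The real source $J_s(\boldsymbol{x},t)$ is supported in space at the antenna and in time in $[-T_b,T_b]$. It has the form $J_s(\boldsymbol{x}(\boldsymbol{x}_s),t)=\delta(y_s)\,b(x_s,t)$,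 where $\boldsymbol{x}_s=(x_s,y_s)$ are rotated and translated coordinates with origin at the center of the antenna, and $b$ describes the cross-range profile and the emitted pulse. Integrals against $J_s$ are understood accordingly. Data. For $t\in\mathbb{R}$, $$D_s(t)=\int_{\mathbb{R}^2}d\boldsymbol{x}\int_{-T_b}^{T_b}dt'\,J_s(\boldsymbol{x},-t')\,u_s(\boldsymbol{x},t-t').$$ Time grid. $T=\inf\{\|\boldsymbol{x}-\boldsymbol{y}\|/c_o:\ \boldsymbol{x}\in\Omega_{\rm im},\ \boldsymbol{y}\in\mathrm{supp}(J_s)\}-T_b$, and it is assumed that $T\gg T_b$ (in particular $T>T_b$). The time step is $\tau>0$ and $M\ge1$ is the number of snapshots, taken at times $m\tau+T$, $0\le m\le M-1$. Inner product. $\langle a,b\rangle=\int_{\mathbb{R}^2}a(\boldsymbol{x})\overline{b(\boldsymbol{x})}\,d\boldsymbol{x}$. *)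

theory Defs
  imports
    "HOL-Analysis.Analysis"
    "Jordan_Normal_Form.Matrix"
begin

type_synonym plane = "real \<times> real"

(* All fields are real valued, so the complex conjugate in the L2 product disappears. *)

definition L2_inner :: "(plane \<Rightarrow> 'b::euclidean_space) \<Rightarrow> (plane \<Rightarrow> 'b) \<Rightarrow> real" where
  "L2_inner f g = (LINT x|lborel. inner (f x) (g x))"

definition sq_integrable :: "(plane \<Rightarrow> 'b::euclidean_space) \<Rightarrow> bool" where
  "sq_integrable f \<longleftrightarrow>
     f \<in> borel_measurable borel \<and> integrable lborel (\<lambda>x. (norm (f x))\<^sup>2)"

(* The curve t \<mapsto> f(., t) is continuously differentiable in L2, with derivative
   t \<mapsto> f'(., t). *)

definition C1_in_time ::
  "(plane \<Rightarrow> real \<Rightarrow> 'b::euclidean_space) \<Rightarrow> (plane \<Rightarrow> real \<Rightarrow> 'b) \<Rightarrow> bool" where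
  "C1_in_time f f' \<longleftrightarrow> (\<forall>t.
     sq_integrable (\<lambda>x. f x t) \<and> sq_integrable (\<lambda>x. f' x t) \<and>
     ((\<lambda>h. LINT x|lborel. (norm ((f x (t + h) - f x t) /\<^sub>R h - f' x t))\<^sup>2) \<longlongrightarrow> 0) (at 0) \<and>
     ((\<lambda>h. LINT x|lborel. (norm (f' x (t + h) - f' x t))\<^sup>2) \<longlongrightarrow> 0) (at 0))"

definition dx :: "(plane \<Rightarrow> real) \<Rightarrow> plane \<Rightarrow> real" where
  "dx f x = frechet_derivative f (at x) (1, 0)"

definition dy :: "(plane \<Rightarrow> real) \<Rightarrow> plane \<Rightarrow> real" where
  "dy f x = frechet_derivative f (at x) (0, 1)"

definition C1_compactly_supported :: "(plane \<Rightarrow> real) \<Rightarrow> bool" where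
  "C1_compactly_supported f \<longleftrightarrow>
     (\<forall>x. f differentiable (at x)) \<and> continuous_on UNIV (dx f) \<and> continuous_on UNIV (dy f) \<and>
     bounded {x. f x \<noteq> 0}"

definition wave_speed :: "real \<Rightarrow> (plane \<Rightarrow> real) \<Rightarrow> plane \<Rightarrow> real" where
  "wave_speed \<mu> \<epsilon> x = 1 / sqrt (\<mu> * \<epsilon> x)"

(* A pair (u, H) of a scalar and a two-component field. *)

type_synonym field_pair = "(plane \<Rightarrow> real) \<times> (plane \<Rightarrow> real \<times> real)"

definition pair_inner :: "field_pair \<Rightarrow> field_pair \<Rightarrow> real" where
  "pair_inner w v = L2_inner (fst w) (fst v) + L2_inner (snd w) (snd v)"

definition wave_op :: "(plane \<Rightarrow> real) \<Rightarrow> field_pair \<Rightarrow> field_pair" where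
  "wave_op c w = (case w of (u, H) \<Rightarrow>
     (\<lambda>x. c x * dy (\<lambda>z. fst (H z)) x - c x * dx (\<lambda>z. snd (H z)) x,
      \<lambda>x. (dy (\<lambda>z. c z * u z) x, - dx (\<lambda>z. c z * u z) x)))"

(* The operator differentiates c u and H, not u itself; requiring c u (rather than u) to be C1
   makes wave_op meaningful on test fields without any smoothness of c. *)

definition test_field :: "(plane \<Rightarrow> real) \<Rightarrow> field_pair \<Rightarrow> bool" where
  "test_field c w \<longleftrightarrow>
     C1_compactly_supported (\<lambda>x. c x * fst w x) \<and>
     C1_compactly_supported (\<lambda>x. fst (snd w x)) \<and>
     C1_compactly_supported (\<lambda>x. snd (snd w x))"

(* The point of the plane with antenna coordinates (x_s, y_s): the coordinates are rotated by
   \<theta> and centered at p. *)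

definition antenna_coords :: "plane \<Rightarrow> real \<Rightarrow> real \<Rightarrow> real \<Rightarrow> plane" where
  "antenna_coords p \<theta> xs ys = p + xs *\<^sub>R (cos \<theta>, sin \<theta>) + ys *\<^sub>R (- sin \<theta>, cos \<theta>)"

definition antenna :: "plane \<Rightarrow> real \<Rightarrow> real \<Rightarrow> plane set" where
  "antenna p \<theta> a = (\<lambda>xs. antenna_coords p \<theta> xs 0) ` {-a..a}"

(* The integral over the plane of \<delta>(y_s) g(x_s) \<phi>(x). The change to antenna coordinates is
   a rigid motion, so it has unit Jacobian. *)

definition line_source_integral ::
  "plane \<Rightarrow> real \<Rightarrow> (real \<Rightarrow> real) \<Rightarrow> (plane \<Rightarrow> real) \<Rightarrow> real" where
  "line_source_integral p \<theta> g \<phi> = (LINT xs|lborel. g xs * \<phi> (antenna_coords p \<theta> xs 0))"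

(* Support in space of the distribution J(x, t) = \<delta>(y_s) b(x_s, t). *)

definition source_support :: "plane \<Rightarrow> real \<Rightarrow> (real \<Rightarrow> real \<Rightarrow> real) \<Rightarrow> plane set" where
  "source_support p \<theta> b =
     {antenna_coords p \<theta> xs 0 | xs.
        \<forall>r>0. \<not> (AE z in (lborel :: (real \<times> real) measure).
                    \<bar>fst z - xs\<bar> < r \<longrightarrow> b (fst z) (snd z) = 0)}"

(* (d/dt + L)(u, H) = (J, 0), weakly in space and classically in time. Since L is skew-adjoint,
   pairing L(u, H) with a test field w amounts to - pair_inner (u, H) (L w). *)

definition wave_equation ::
  "(plane \<Rightarrow> real) \<Rightarrow> plane \<Rightarrow> real \<Rightarrow> (real \<Rightarrow> real \<Rightarrow> real) \<Rightarrow>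
   (plane \<Rightarrow> real \<Rightarrow> real) \<Rightarrow> (plane \<Rightarrow> real \<Rightarrow> real \<times> real) \<Rightarrow> bool" where
  "wave_equation c p \<theta> b u H \<longleftrightarrow>
     (\<exists>ut Ht. C1_in_time u ut \<and> C1_in_time H Ht \<and>
        (\<forall>t w. test_field c w \<longrightarrow>
           pair_inner (\<lambda>x. ut x t, \<lambda>x. Ht x t) w
             - pair_inner (\<lambda>x. u x t, \<lambda>x. H x t) (wave_op c w)
           = line_source_integral p \<theta> (\<lambda>xs. b xs t) (fst w)))"

definition data ::
  "plane \<Rightarrow> real \<Rightarrow> (real \<Rightarrow> real \<Rightarrow> real) \<Rightarrow> real \<Rightarrow> (plane \<Rightarrow> real \<Rightarrow> real) \<Rightarrow> real \<Rightarrow> real" where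
  "data p \<theta> b Tb u t =
     (LINT xs|lborel. (LINT t':{-Tb..Tb}|lborel.
        b xs (- t') * u (antenna_coords p \<theta> xs 0) (t - t')))"

definition travel_time_offset ::
  "real \<Rightarrow> plane set \<Rightarrow> plane set \<Rightarrow> real \<Rightarrow> real" where
  "travel_time_offset co \<Omega> S Tb = Inf {norm (x - y) / co | x y. x \<in> \<Omega> \<and> y \<in> S} - Tb"

definition snapshot ::
  "(plane \<Rightarrow> real \<Rightarrow> real) \<Rightarrow> real \<Rightarrow> real \<Rightarrow> nat \<Rightarrow> plane \<Rightarrow> real" where
  "snapshot u \<tau> T m = (\<lambda>x. u x (real m * \<tau> + T))"

definition gramian :: "nat \<Rightarrow> (nat \<Rightarrow> plane \<Rightarrow> real) \<Rightarrow> real Matrix.mat" where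
  "gramian M v = Matrix.mat M M (\<lambda>(m, j). L2_inner (v m) (v j))"

definition toeplitz :: "real Matrix.mat \<Rightarrow> bool" where
  "toeplitz A \<longleftrightarrow> (\<exists>f :: int \<Rightarrow> real.
     \<forall>i<dim_row A. \<forall>j<dim_col A. A $$ (i, j) = f (int i - int j))"

definition hankel :: "real Matrix.mat \<Rightarrow> bool" where
  "hankel A \<longleftrightarrow> (\<exists>f :: nat \<Rightarrow> real.
     \<forall>i<dim_row A. \<forall>j<dim_col A. A $$ (i, j) = f (i + j))"

end

theory Submission
  imports Defs
begin

text \<open>
  Write \<open>g(t, s) = \<langle>u(t), u(s)\<rangle>\<close>, \<open>h(t, s) = \<langle>H(t), H(s)\<rangle>\<close> and \<open>j(t, s) = \<langle>J(t), u(s)\<rangle>\<close>. Using the solution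
  at time \<open>s\<close> as a test function for the equation at time \<open>t\<close> gives
  \<open>\<langle>u'(t), u(s)\<rangle> + \<langle>H(t), H'(s)\<rangle> = j(t, s)\<close>, because the operator is skew-adjoint. Hence
  \<open>g + h\<close> has derivative \<open>j(t, s) + j(s, t)\<close> in the direction \<open>(1, 1)\<close>, and \<open>g - h\<close> has derivative
  \<open>j(t, s) - j(s, t)\<close> in the direction \<open>(1, -1)\<close>. Both vanish as soon as one of the times precedes the
  source. Integrating along these lines from a point with \<open>t, s > T\<^sub>b\<close> sweeps over the whole source
  interval, so evenness of the source turns the integrals into the data:
  \<open>g + h = D(s - t) + D(t - s)\<close> and \<open>g - h = D(t + s)\<close>.

  The fields are only in \<open>L\<^sup>2\<close>, so the solution has to be smeared before it may serve as a test
  function, and the identity is then recovered from the continuity of translations in \<open>L\<^sup>2\<close>.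
\<close>

no_notation Matrix.scalar_prod (infix \<open>\<bullet>\<close> 70)

subsection \<open>Square-integrable fields\<close>

lemma sq_integrable_measurable [measurable_dest]:
  "sq_integrable f \<Longrightarrow> f \<in> borel_measurable borel"
  by (simp add: sq_integrable_def)

lemma sq_integrable_dominated:
  fixes f :: "plane \<Rightarrow> 'b::euclidean_space"
  assumes "f \<in> borel_measurable borel" "integrable lborel g" "\<And>x. (norm (f x))\<^sup>2 \<le> g x"
  shows "sq_integrable f"
  unfolding sq_integrable_def
proof
  show "integrable lborel (\<lambda>x. (norm (f x))\<^sup>2)"
    using assms(1,3)
    by (intro Bochner_Integration.integrable_bound[OF assms(2)])
      (auto simp: order_trans[OF assms(3) abs_ge_self])
qed (fact assms(1))

lemma sq_integrable_add:
  fixes f g :: "plane \<Rightarrow> 'b::euclidean_space"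
  assumes [measurable]: "sq_integrable f" "sq_integrable g"
  shows "sq_integrable (\<lambda>x. f x + g x)"
proof (rule sq_integrable_dominated)
  show "integrable lborel (\<lambda>x. 2 * (norm (f x))\<^sup>2 + 2 * (norm (g x))\<^sup>2)"
    using assms by (auto simp: sq_integrable_def)
  show "(norm (f x + g x))\<^sup>2 \<le> 2 * (norm (f x))\<^sup>2 + 2 * (norm (g x))\<^sup>2" for x
  proof -
    have "(norm (f x + g x))\<^sup>2 \<le> (norm (f x) + norm (g x))\<^sup>2"
      by (simp add: norm_triangle_ineq power_mono)
    also have "\<dots> \<le> 2 * (norm (f x))\<^sup>2 + 2 * (norm (g x))\<^sup>2"
      using sum_squares_bound[of "norm (f x)" "norm (g x)"] by (simp add: power2_sum)
    finally show ?thesis .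
  qed
qed measurable

lemma sq_integrable_scaleR:
  fixes f :: "plane \<Rightarrow> 'b::euclidean_space"
  assumes "sq_integrable f"
  shows "sq_integrable (\<lambda>x. k *\<^sub>R f x)"
  using assms by (auto simp: sq_integrable_def power_mult_distrib)

lemma sq_integrable_diff:
  fixes f g :: "plane \<Rightarrow> 'b::euclidean_space"
  assumes "sq_integrable f" "sq_integrable g"
  shows "sq_integrable (\<lambda>x. f x - g x)"
  using sq_integrable_add[OF assms(1) sq_integrable_scaleR[OF assms(2), of "-1"]] by simp

lemma integrable_inner_L2:
  fixes f g :: "plane \<Rightarrow> 'b::euclidean_space"
  assumes [measurable]: "sq_integrable f" "sq_integrable g"
  shows "integrable lborel (\<lambda>x. inner (f x) (g x))"
proof (rule Bochner_Integration.integrable_bound)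
  show "integrable lborel (\<lambda>x. (norm (f x))\<^sup>2 + (norm (g x))\<^sup>2)"
    using assms by (auto simp: sq_integrable_def)
  show "AE x in lborel. norm (inner (f x) (g x)) \<le> norm ((norm (f x))\<^sup>2 + (norm (g x))\<^sup>2)"
  proof (intro AE_I2)
    fix x
    have "\<bar>inner (f x) (g x)\<bar> \<le> norm (f x) * norm (g x)"
      by (rule Cauchy_Schwarz_ineq2)
    also have "\<dots> \<le> (norm (f x))\<^sup>2 + (norm (g x))\<^sup>2"
      using sum_squares_bound[of "norm (f x)" "norm (g x)"]
        mult_nonneg_nonneg[OF norm_ge_zero norm_ge_zero, of "f x" "g x"] by linarith
    finally show "norm (inner (f x) (g x)) \<le> norm ((norm (f x))\<^sup>2 + (norm (g x))\<^sup>2)" by simp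
  qed
qed measurable

section \<open>Inner product: bilinearity, Cauchy-Schwarz and limits\<close>

lemma L2_inner_commute: "L2_inner f g = L2_inner g f"
  by (simp add: L2_inner_def inner_commute)

lemma L2_inner_diff_left:
  assumes "sq_integrable f" "sq_integrable f'" "sq_integrable g"
  shows "L2_inner (\<lambda>x. f x - f' x) g = L2_inner f g - L2_inner f' g"
  using assms by (simp add: L2_inner_def inner_diff_left integrable_inner_L2)

lemma L2_inner_diff_right:
  assumes "sq_integrable f" "sq_integrable g" "sq_integrable g'"
  shows "L2_inner f (\<lambda>x. g x - g' x) = L2_inner f g - L2_inner f g'"
  using assms by (simp add: L2_inner_def inner_diff_right integrable_inner_L2)

lemma L2_inner_scaleR_left: "L2_inner (\<lambda>x. k *\<^sub>R f x) g = k * L2_inner f g"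
  by (simp add: L2_inner_def)

lemma L2_inner_scaleR_right: "L2_inner f (\<lambda>x. k *\<^sub>R g x) = k * L2_inner f g"
  by (simp add: L2_inner_def)

lemma L2_inner_self: "L2_inner f f = (LINT x|lborel. (norm (f x))\<^sup>2)"
  by (simp add: L2_inner_def power2_norm_eq_inner)

lemma L2_inner_self_nonneg: "0 \<le> L2_inner f f"
  by (simp add: L2_inner_def)

text \<open>The squared norm of \<open>f - t g\<close> is a nonnegative polynomial of degree at most
  two in \<open>t\<close>; a suitable value of \<open>t\<close> gives the inequality. The leading
  coefficient vanishes when \<open>g\<close> is zero almost everywhere, so that case is treated
  apart.\<close>

lemma L2_Cauchy_Schwarz:
  assumes f: "sq_integrable f" and g: "sq_integrable g"
  shows "(L2_inner f g)\<^sup>2 \<le> L2_inner f f * L2_inner g g"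
proof -
  let ?A = "L2_inner f f" and ?B = "L2_inner f g" and ?C = "L2_inner g g"
  have quad: "0 \<le> ?A - 2 * t * ?B + t\<^sup>2 * ?C" for t
  proof -
    let ?h = "\<lambda>x. f x - t *\<^sub>R g x"
    note tg = sq_integrable_scaleR[OF g, of t]
    note h = sq_integrable_diff[OF f tg]
    have "L2_inner ?h ?h = ?A - 2 * t * ?B + t\<^sup>2 * ?C"
      using L2_inner_diff_left[OF f tg h] L2_inner_diff_right[OF f f tg]
        L2_inner_diff_right[OF tg f tg] L2_inner_commute[of g f]
      by (simp add: L2_inner_scaleR_left L2_inner_scaleR_right power2_eq_square algebra_simps)
    then show ?thesis using L2_inner_self_nonneg[of ?h] by simp
  qed
  show ?thesis
  proof (cases "?C = 0")
    case True
    have "?B = 0"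
    proof (rule ccontr)
      assume "?B \<noteq> 0"
      \<comment> \<open>With leading coefficient 0 the polynomial is affine, and this argument makes
        it equal to -1.\<close>
      with quad[of "(?A + 1) / (2 * ?B)"] True show False by simp
    qed
    with True show ?thesis by simp
  next
    case False
    then have "?C > 0" using L2_inner_self_nonneg[of g] by linarith
    \<comment> \<open>The argument is the minimiser of the quadratic.\<close>
    with quad[of "?B / ?C"] show ?thesis
      by (simp add: power2_eq_square field_simps)
  qed
qed

text \<open>Cauchy-Schwarz bounds the product by a null factor times a convergent one. Letting
  \<open>g\<close> depend on \<open>h\<close> covers products of two differences as well as a fixed
  \<open>g\<close>.\<close>

lemma L2_inner_tendsto_0:
  assumes f: "\<And>h. sq_integrable (f h)" and g: "\<And>h. sq_integrable (g h)"
    and lf: "((\<lambda>h. L2_inner (f h) (f h)) \<longlongrightarrow> 0) F"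
    and lg: "((\<lambda>h. L2_inner (g h) (g h)) \<longlongrightarrow> c) F"
  shows "((\<lambda>h. L2_inner (f h) (g h)) \<longlongrightarrow> 0) F"
proof (rule Lim_null_comparison)
  show "\<forall>\<^sub>F h in F. norm (L2_inner (f h) (g h)) \<le> sqrt (L2_inner (f h) (f h) * L2_inner (g h) (g h))"
    using L2_Cauchy_Schwarz[OF f g] by (auto intro!: always_eventually real_le_rsqrt)
  show "((\<lambda>h. sqrt (L2_inner (f h) (f h) * L2_inner (g h) (g h))) \<longlongrightarrow> 0) F"
    using tendsto_real_sqrt[OF tendsto_mult[OF lf lg]] by simp
qed

lemma L2_inner_tendsto:
  assumes f: "\<And>h. sq_integrable (f h)" "sq_integrable f0"
    and g: "\<And>h. sq_integrable (g h)" "sq_integrable g0"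
    and lf: "((\<lambda>h. L2_inner (\<lambda>x. f h x - f0 x) (\<lambda>x. f h x - f0 x)) \<longlongrightarrow> 0) F"
    and lg: "((\<lambda>h. L2_inner (\<lambda>x. g h x - g0 x) (\<lambda>x. g h x - g0 x)) \<longlongrightarrow> 0) F"
  shows "((\<lambda>h. L2_inner (f h) (g h)) \<longlongrightarrow> L2_inner f0 g0) F"
proof -
  note fd = sq_integrable_diff[OF f] and gd = sq_integrable_diff[OF g]
  \<comment> \<open>Expansion about the limit pair: each of the first three terms contains a factor
    tending to zero in L2.\<close>
  have eq: "L2_inner (f h) (g h) = L2_inner (\<lambda>x. f h x - f0 x) (\<lambda>x. g h x - g0 x)
      + L2_inner (\<lambda>x. f h x - f0 x) g0 + L2_inner (\<lambda>x. g h x - g0 x) f0 + L2_inner f0 g0" for h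
    using L2_inner_diff_left[OF f(1) f(2) gd] L2_inner_diff_left[OF f(1) f(2) g(2)]
      L2_inner_diff_left[OF g(1) g(2) f(2)] L2_inner_diff_right[OF f(1) g(1) g(2)]
      L2_inner_diff_right[OF f(2) g(1) g(2)] L2_inner_commute[of g0 f0] L2_inner_commute[of "g h" f0]
    by simp
  have "((\<lambda>h. L2_inner (\<lambda>x. f h x - f0 x) (\<lambda>x. g h x - g0 x)
      + L2_inner (\<lambda>x. f h x - f0 x) g0 + L2_inner (\<lambda>x. g h x - g0 x) f0 + L2_inner f0 g0)
      \<longlongrightarrow> 0 + 0 + 0 + L2_inner f0 g0) F"
    by (intro tendsto_add L2_inner_tendsto_0[OF fd gd lf lg] tendsto_const
        L2_inner_tendsto_0[OF fd g(2) lf tendsto_const]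
        L2_inner_tendsto_0[OF gd f(2) lg tendsto_const])
  then show ?thesis by (simp add: eq)
qed

text \<open>Time is the first argument, so that a curve is shifted or rescaled by composing with a
  function of time. Square integrability is asked at every time because the difference quotients use
  neighbouring times.\<close>

definition L2_deriv :: "(real \<Rightarrow> plane \<Rightarrow> 'b::euclidean_space) \<Rightarrow> (plane \<Rightarrow> 'b) \<Rightarrow> real \<Rightarrow> bool" where
  "L2_deriv f f' t \<longleftrightarrow> (\<forall>t. sq_integrable (f t)) \<and> sq_integrable f' \<and>
     ((\<lambda>h. LINT x|lborel. (norm ((f (t + h) x - f t x) /\<^sub>R h - f' x))\<^sup>2) \<longlongrightarrow> 0) (at 0)"

text \<open>The quotient with step \<open>h\<close> along the new curve is \<sigma> times the old
  quotient with step \<open>\<sigma> * h\<close>. This chain rule is what allows differentiation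
  along the directions (1, 1) and (1, -1) in the plane of two times.\<close>

lemma L2_deriv_affine:
  assumes d: "L2_deriv f f' (t + \<sigma> * r)" and \<sigma>: "\<sigma> \<noteq> 0"
  shows "L2_deriv (\<lambda>r. f (t + \<sigma> * r)) (\<lambda>x. \<sigma> *\<^sub>R f' x) r"
proof -
  have lim: "filterlim (\<lambda>h. \<sigma> * h) (at 0) (at 0)"
    unfolding filterlim_at using \<sigma>
    by (auto intro!: tendsto_eq_intros simp: eventually_at_filter)
  let ?q = "\<lambda>h. LINT x|lborel. (norm ((f (t + \<sigma> * r + h) x - f (t + \<sigma> * r) x) /\<^sub>R h - f' x))\<^sup>2"
  have "(?q \<longlongrightarrow> 0) (at 0)" using d by (simp add: L2_deriv_def)
  from tendsto_mult_right_zero[OF filterlim_compose[OF this lim], of "\<sigma>\<^sup>2"]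
  have "((\<lambda>h. \<sigma>\<^sup>2 * ?q (\<sigma> * h)) \<longlongrightarrow> 0) (at 0)" by simp
  moreover have "\<sigma>\<^sup>2 * ?q (\<sigma> * h) = (LINT x|lborel. (norm ((f (t + \<sigma> * (r + h)) x - f (t + \<sigma> * r) x) /\<^sub>R h - \<sigma> *\<^sub>R f' x))\<^sup>2)" for h
  proof -
    \<comment> \<open>This also covers \<open>h = 0\<close>, since
      \<open>inverse 0 = 0\<close>.\<close>
    have "(f (t + \<sigma> * (r + h)) x - f (t + \<sigma> * r) x) /\<^sub>R h - \<sigma> *\<^sub>R f' x
      = \<sigma> *\<^sub>R ((f (t + \<sigma> * r + \<sigma> * h) x - f (t + \<sigma> * r) x) /\<^sub>R (\<sigma> * h) - f' x)" for x
    proof -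
      have "\<sigma> * (inverse \<sigma> * inverse h) = inverse h" using \<sigma> by (simp add: field_simps)
      then show ?thesis
        by (simp only: scaleR_diff_right scaleR_scaleR inverse_mult_distrib distrib_left add.assoc)
    qed
    then show ?thesis by (simp add: power_mult_distrib)
  qed
  ultimately show ?thesis
    using d by (auto simp: L2_deriv_def sq_integrable_scaleR)
qed

text \<open>The usual splitting: the quotient of \<open>f\<close> is paired with
  \<open>g (t + h)\<close>, and \<open>f t\<close> with the quotient of \<open>g\<close>. The
  shifted factor calls for L2 continuity of \<open>g\<close> at \<open>t\<close>, which follows from
  differentiability.\<close>

lemma L2_deriv_inner:
  assumes f: "L2_deriv f f' t" and g: "L2_deriv g g' t"
  shows "((\<lambda>t. L2_inner (f t) (g t)) has_real_derivative L2_inner f' (g t) + L2_inner (f t) g') (at t)"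
proof -
  have sf: "\<And>t. sq_integrable (f t)" "sq_integrable f'" and sg: "\<And>t. sq_integrable (g t)" "sq_integrable g'"
    using f g by (auto simp: L2_deriv_def)
  define qf where "qf = (\<lambda>h x. inverse h *\<^sub>R (f (t + h) x - f t x))"
  define qg where "qg = (\<lambda>h x. inverse h *\<^sub>R (g (t + h) x - g t x))"
  have sqf: "sq_integrable (qf h)" and sqg: "sq_integrable (qg h)" for h
    unfolding qf_def qg_def by (intro sq_integrable_scaleR sq_integrable_diff sf sg)+
  have lf: "((\<lambda>h. L2_inner (\<lambda>x. qf h x - f' x) (\<lambda>x. qf h x - f' x)) \<longlongrightarrow> 0) (at 0)"
    and lg: "((\<lambda>h. L2_inner (\<lambda>x. qg h x - g' x) (\<lambda>x. qg h x - g' x)) \<longlongrightarrow> 0) (at 0)"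
    using f g by (simp_all add: L2_inner_self qf_def qg_def L2_deriv_def)
  have cg: "((\<lambda>h. L2_inner (\<lambda>x. g (t + h) x - g t x) (\<lambda>x. g (t + h) x - g t x)) \<longlongrightarrow> 0) (at 0)"
  proof -
    \<comment> \<open>The squared increment of \<open>g\<close> is h^2 times the squared norm of the
      quotient \<open>qg h\<close>, and the latter converges.\<close>
    have "((\<lambda>h. h\<^sup>2 * L2_inner (qg h) (qg h)) \<longlongrightarrow> 0\<^sup>2 * L2_inner g' g') (at 0)"
      by (intro tendsto_mult tendsto_power tendsto_ident_at L2_inner_tendsto sqg sg lg)
    moreover have "h\<^sup>2 * L2_inner (qg h) (qg h) = L2_inner (\<lambda>x. g (t + h) x - g t x) (\<lambda>x. g (t + h) x - g t x)"
      if "h \<noteq> 0" for h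
      unfolding qg_def L2_inner_scaleR_left L2_inner_scaleR_right
      using that by (simp add: power2_eq_square field_simps)
    ultimately show ?thesis
      by (auto elim!: Lim_transform_eventually simp: eventually_at_filter)
  qed
  have "((\<lambda>h. L2_inner (qf h) (g (t + h)) + L2_inner (f t) (qg h)) \<longlongrightarrow> L2_inner f' (g t) + L2_inner (f t) g') (at 0)"
    by (intro tendsto_add L2_inner_tendsto sqf sqg sf sg lf lg cg) (simp add: L2_inner_def)
  moreover have "L2_inner (qf h) (g (t + h)) + L2_inner (f t) (qg h)
      = (L2_inner (f (t + h)) (g (t + h)) - L2_inner (f t) (g t)) / h" for h
    using L2_inner_diff_left[OF sf(1) sf(1) sg(1), of "t + h" t "t + h"]
      L2_inner_diff_right[OF sf(1) sg(1) sg(1), of t "t + h" t]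
    unfolding qf_def qg_def L2_inner_scaleR_left L2_inner_scaleR_right distrib_left[symmetric]
    by (simp add: divide_inverse mult.commute)
  ultimately show ?thesis by (simp add: DERIV_def)
qed

subsection \<open>Continuity of translations\<close>

lemma L2_dominated_convergence:
  fixes f :: "plane \<Rightarrow> real"
  assumes [measurable]: "f \<in> borel_measurable borel" "\<And>n. s n \<in> borel_measurable borel"
    and w: "integrable lborel w"
    and lim: "AE x in lborel. (\<lambda>n. s n x) \<longlonglongrightarrow> f x"
    and bound: "\<And>n. AE x in lborel. (s n x - f x)\<^sup>2 \<le> w x"
  shows "(\<lambda>n. LINT x|lborel. (s n x - f x)\<^sup>2) \<longlonglongrightarrow> 0"
proof -
  have "(\<lambda>n. LINT x|lborel. (s n x - f x)\<^sup>2) \<longlonglongrightarrow> (LINT x::plane|lborel. (0::real))"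
  proof (rule integral_dominated_convergence[where w = w])
    show "AE x in lborel. (\<lambda>n. (s n x - f x)\<^sup>2) \<longlonglongrightarrow> 0"
      using lim
    proof eventually_elim
      case (elim x)
      then show ?case using tendsto_power[OF tendsto_diff[OF elim tendsto_const], of "f x" 2] by simp
    qed
    show "AE x in lborel. norm ((s n x - f x)\<^sup>2) \<le> w x" for n
      using bound[of n] by simp
  qed (use w in measurable)
  then show ?thesis by simp
qed

section \<open>Density of bounded continuous functions of bounded support in L2\<close>

lemma cball_measurable [measurable]: "cball (x::plane) r \<in> sets borel"
  by simp

text \<open>Clamping large values, rather than replacing them by zero, is continuous, so clipping
  passes through pointwise limits.\<close>

definition clip :: "real \<Rightarrow> real \<Rightarrow> real" where
  "clip B v = max (- B) (min B v)"

lemma clip_measurable [measurable (raw)]: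
  "f \<in> borel_measurable N \<Longrightarrow> (\<lambda>x. clip B (f x)) \<in> borel_measurable N"
  unfolding clip_def by (intro borel_measurable_max borel_measurable_min borel_measurable_const)

lemma isCont_clip: "isCont (clip B) v"
  unfolding clip_def by (intro continuous_intros)

lemma abs_clip_le: "0 \<le> B \<Longrightarrow> \<bar>clip B v\<bar> \<le> B"
  by (auto simp: clip_def)

text \<open>One parameter serves as radius and as height. At each point the approximant eventually
  equals \<open>f\<close>; it always lies between 0 and \<open>f\<close>, so the squared error is
  dominated by \<open>(f x)\<^sup>2\<close>.\<close>

lemma sq_integrable_clip_approx:
  fixes f :: "plane \<Rightarrow> real"
  assumes f: "sq_integrable f" and e: "0 < e"
  obtains k :: nat where
    "(LINT x|lborel. (indicator (cball 0 k) x * clip k (f x) - f x)\<^sup>2) < e"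
proof -
  note [measurable] = sq_integrable_measurable[OF f]
  define s where "s = (\<lambda>(k::nat) x. indicator (cball 0 (real k)) x * clip (real k) (f x))"
  have "(\<lambda>k. LINT x|lborel. (s k x - f x)\<^sup>2) \<longlonglongrightarrow> 0"
  proof (rule L2_dominated_convergence)
    show "integrable lborel (\<lambda>x. (f x)\<^sup>2)" using f by (simp add: sq_integrable_def)
    show "AE x in lborel. (\<lambda>k. s k x) \<longlonglongrightarrow> f x"
    proof (intro AE_I2 tendsto_eventually)
      fix x
      obtain N :: nat where N: "norm x \<le> N" "\<bar>f x\<bar> \<le> N"
        using real_arch_simple[of "max (norm x) \<bar>f x\<bar>"] by auto
      show "\<forall>\<^sub>F k in sequentially. s k x = f x"
        using eventually_ge_at_top[of N]
      proof eventually_elim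
        case (elim k)
        with N have "norm x \<le> k" "\<bar>f x\<bar> \<le> k" by (auto intro: order_trans)
        then show ?case by (auto simp: s_def clip_def)
      qed
    qed
    show "AE x in lborel. (s k x - f x)\<^sup>2 \<le> (f x)\<^sup>2" for k
      by (intro AE_I2 abs_le_square_iff[THEN iffD1]) (auto simp: s_def clip_def indicator_def)
    show "s k \<in> borel_measurable borel" for k unfolding s_def by measurable
  qed measurable
  with e have "\<forall>\<^sub>F k in sequentially. (LINT x|lborel. (s k x - f x)\<^sup>2) < e"
    by (simp add: order_tendstoD)
  then obtain k where "(LINT x|lborel. (s k x - f x)\<^sup>2) < e"
    using eventually_happens' sequentially_bot by blast
  with that show ?thesis unfolding s_def by blast
qed

text \<open>A continuous ramp in place of the indicator of a ball, so that multiplying by it keeps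
  continuity.\<close>

definition cutoff :: "real \<Rightarrow> plane \<Rightarrow> real" where
  "cutoff R x = max 0 (min 1 (R + 1 - norm x))"

lemma cutoff_bounds: "0 \<le> cutoff R x" "cutoff R x \<le> 1"
  by (auto simp: cutoff_def)

lemma cutoff_eq_1: "norm x \<le> R \<Longrightarrow> cutoff R x = 1"
  by (auto simp: cutoff_def)

lemma cutoff_eq_0: "R + 1 \<le> norm x \<Longrightarrow> cutoff R x = 0"
  by (auto simp: cutoff_def)

lemma continuous_on_cutoff: "continuous_on UNIV (cutoff R)"
  unfolding cutoff_def by (intro continuous_intros)

lemma integrable_indicator_cball:
  "integrable lborel (\<lambda>x::plane. indicator (cball 0 R) x * (K::real))"
  using emeasure_lborel_cball_finite[of "0::plane" R]
  by (intro integrable_mult_left integrable_real_indicator) auto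

text \<open>First \<open>f\<close> is replaced by a bounded function of bounded support, then that
  one by continuous functions converging to it almost everywhere. Clipping and cutting off the
  latter leaves the limit unchanged and supplies the dominating function for L2 convergence.\<close>

lemma sq_integrable_continuous_approx:
  fixes f :: "plane \<Rightarrow> real"
  assumes f: "sq_integrable f" and e: "0 < e"
  obtains g B R where "continuous_on UNIV g" "\<And>x. \<bar>g x\<bar> \<le> B" "\<And>x. R \<le> norm x \<Longrightarrow> g x = 0"
    "(LINT x|lborel. (g x - f x)\<^sup>2) < e"
proof -
  note [measurable] = sq_integrable_measurable[OF f]
  \<comment> \<open>Two errors below e / 4 fit into
    \<open>(p + q)^2 <= 2 p^2 + 2 q^2\<close>.\<close>
  obtain k :: nat where k: "(LINT x|lborel. (indicator (cball 0 k) x * clip k (f x) - f x)\<^sup>2) < e / 4"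
    using sq_integrable_clip_approx[OF f, of "e / 4"] e by auto
  define fk where "fk = (\<lambda>x. indicator (cball 0 (real k)) x * clip (real k) (f x))"
  have fk_meas [measurable]: "fk \<in> borel_measurable borel" unfolding fk_def by measurable
  have fk_bound: "\<bar>fk x\<bar> \<le> k" for x
    using abs_clip_le[of "real k" "f x"] by (auto simp: fk_def indicator_def)
  \<comment> \<open>Unfolding \<open>measurable_on\<close> produces the continuous functions, with
    convergence off a negligible set.\<close>
  have "fk measurable_on UNIV"
    by (intro lebesgue_measurable_imp_measurable_on measurable_completion) auto
  then obtain N g where N: "negligible N" and g: "\<And>n. continuous_on UNIV (g n)"
    and lim: "\<And>x. x \<notin> N \<Longrightarrow> (\<lambda>n. g n x) \<longlonglongrightarrow> fk x"
    by (auto simp: measurable_on_def)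
  define s where "s = (\<lambda>n x. cutoff (real k) x * clip (real k) (g n x))"
  have s_cont: "continuous_on UNIV (s n)" for n
    unfolding s_def
    by (intro continuous_intros continuous_on_cutoff continuous_on_compose2[of UNIV "clip _", OF _ g])
      (auto simp: continuous_on_eq_continuous_at isCont_clip)
  have s_bound: "\<bar>s n x\<bar> \<le> k" for n x
    using mult_mono[of "\<bar>cutoff k x\<bar>" 1 "\<bar>clip k (g n x)\<bar>" k] abs_clip_le[of "real k" "g n x"] cutoff_bounds[of k x]
    by (simp add: s_def abs_mult)
  have s_0: "s n x = 0" if "real k + 1 \<le> norm x" for n x
    using that by (simp add: s_def cutoff_eq_0)
  have [measurable]: "s n \<in> borel_measurable borel" for n
    using s_cont by (rule borel_measurable_continuous_onI)
  have "AE x in lebesgue. x \<notin> N"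
    using N by (intro AE_not_in) (simp add: negligible_iff_null_sets)
  then have AE_N: "AE x in lborel. x \<notin> N" by (simp add: AE_completion_iff)
  have "(\<lambda>n. LINT x|lborel. (s n x - fk x)\<^sup>2) \<longlonglongrightarrow> 0"
  proof (rule L2_dominated_convergence)
    show "integrable lborel (\<lambda>x::plane. indicator (cball 0 (real k + 1)) x * (2 * real k)\<^sup>2)"
      by (rule integrable_indicator_cball)
    show "AE x in lborel. (\<lambda>n. s n x) \<longlonglongrightarrow> fk x"
      using AE_N
    proof eventually_elim
      case (elim x)
      have "(\<lambda>n. s n x) \<longlonglongrightarrow> cutoff k x * clip k (fk x)"
        unfolding s_def
        by (intro tendsto_mult tendsto_const isCont_tendsto_compose[OF isCont_clip] lim elim)
      moreover have "cutoff k x * clip k (fk x) = fk x"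
        using fk_bound[of x] cutoff_eq_1[of x k] by (auto simp: fk_def clip_def indicator_def)
      ultimately show ?case by simp
    qed
    show "AE x in lborel. (s n x - fk x)\<^sup>2 \<le> indicator (cball 0 (real k + 1)) x * (2 * real k)\<^sup>2" for n
    proof (rule AE_I2)
      fix x :: plane
      show "(s n x - fk x)\<^sup>2 \<le> indicator (cball 0 (real k + 1)) x * (2 * real k)\<^sup>2"
      proof (cases "norm x \<le> real k + 1")
        case True
        have "\<bar>s n x - fk x\<bar> \<le> \<bar>2 * real k\<bar>"
          using s_bound[of n x] fk_bound[of x] by linarith
        then have "(s n x - fk x)\<^sup>2 \<le> (2 * real k)\<^sup>2" by (simp only: abs_le_square_iff)
        then show ?thesis using True by simp
      next
        case False
        then show ?thesis by (simp add: s_0 fk_def)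
      qed
    qed
  qed measurable
  then have "\<forall>\<^sub>F n in sequentially. (LINT x|lborel. (s n x - fk x)\<^sup>2) < e / 4"
    by (rule order_tendstoD(2)) (use e in simp)
  then obtain n where n: "(LINT x|lborel. (s n x - fk x)\<^sup>2) < e / 4"
    using eventually_happens' sequentially_bot by blast
  have s_L2: "sq_integrable (s n)"
  proof (rule sq_integrable_dominated)
    show "integrable lborel (\<lambda>x::plane. indicator (cball 0 (real k + 1)) x * (real k)\<^sup>2)"
      by (rule integrable_indicator_cball)
    show "(norm (s n x))\<^sup>2 \<le> indicator (cball 0 (real k + 1)) x * (real k)\<^sup>2" for x
      using s_bound[of n x] s_0[of x n] power_mono[of "\<bar>s n x\<bar>" k 2] by (auto simp: indicator_def)
  qed measurable
  have fk_L2: "sq_integrable fk"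
  proof (rule sq_integrable_dominated)
    show "integrable lborel (\<lambda>x. (norm (f x))\<^sup>2)" using f by (simp add: sq_integrable_def)
    show "(norm (fk x))\<^sup>2 \<le> (norm (f x))\<^sup>2" for x
      by (auto simp: fk_def clip_def indicator_def abs_le_square_iff[symmetric])
  qed measurable
  have "(LINT x|lborel. (s n x - f x)\<^sup>2) \<le> (LINT x|lborel. 2 * (s n x - fk x)\<^sup>2 + 2 * (fk x - f x)\<^sup>2)"
  proof (rule integral_mono)
    show "integrable lborel (\<lambda>x. (s n x - f x)\<^sup>2)"
      using sq_integrable_diff[OF s_L2 f] by (simp add: sq_integrable_def)
    show "integrable lborel (\<lambda>x. 2 * (s n x - fk x)\<^sup>2 + 2 * (fk x - f x)\<^sup>2)"
      using sq_integrable_diff[OF s_L2 fk_L2] sq_integrable_diff[OF fk_L2 f] by (simp add: sq_integrable_def)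
    show "(s n x - f x)\<^sup>2 \<le> 2 * (s n x - fk x)\<^sup>2 + 2 * (fk x - f x)\<^sup>2" for x
      using sum_squares_bound[of "s n x - fk x" "fk x - f x"] by (simp add: power2_eq_square algebra_simps)
  qed
  also have "\<dots> = 2 * (LINT x|lborel. (s n x - fk x)\<^sup>2) + 2 * (LINT x|lborel. (fk x - f x)\<^sup>2)"
    using sq_integrable_diff[OF s_L2 fk_L2] sq_integrable_diff[OF fk_L2 f] by (simp add: sq_integrable_def)
  also have "\<dots> < e" using n k by (simp add: fk_def)
  finally show ?thesis using that[OF s_cont s_bound s_0] by blast
qed

section \<open>Translations of square-integrable functions\<close>

lemma LINT_translate:
  fixes f :: "plane \<Rightarrow> real"
  assumes [measurable]: "f \<in> borel_measurable borel"
  shows "(LINT x|lborel. f (x - y)) = (LINT x|lborel. f x)"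
    "integrable lborel (\<lambda>x. f (x - y)) \<longleftrightarrow> integrable lborel f"
proof -
  have eq: "lborel = distr lborel borel (\<lambda>x::plane. x - y)"
    using lborel_distr_plus[of "- y"] unfolding add.commute[of "- y"] by simp
  show "(LINT x|lborel. f (x - y)) = (LINT x|lborel. f x)"
    by (subst (2) eq) (simp add: integral_distr)
  show "integrable lborel (\<lambda>x. f (x - y)) \<longleftrightarrow> integrable lborel f"
    by (subst (2) eq) (simp add: integrable_distr_eq)
qed

lemma sq_integrable_translate:
  fixes f :: "plane \<Rightarrow> 'b::euclidean_space"
  assumes "sq_integrable f"
  shows "sq_integrable (\<lambda>x. f (x - y))"
proof -
  note [measurable] = sq_integrable_measurable[OF assms]
  show ?thesis
    using assms LINT_translate(2)[of "\<lambda>x. (norm (f x))\<^sup>2" y] by (simp add: sq_integrable_def)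
qed

text \<open>Along a null sequence of shifts, bounded by some \<open>K\<close>, all translates vanish
  outside the ball of radius \<open>R + K\<close>, so a constant on that ball dominates; continuity
  gives the pointwise limit.\<close>

lemma L2_translate_tendsto_continuous:
  fixes g :: "plane \<Rightarrow> real"
  assumes g: "continuous_on UNIV g" "\<And>x. \<bar>g x\<bar> \<le> B" "\<And>x. R \<le> norm x \<Longrightarrow> g x = 0"
  shows "((\<lambda>y. LINT x|lborel. (g (x - y) - g x)\<^sup>2) \<longlongrightarrow> 0) (at 0)"
  unfolding tendsto_at_iff_sequentially
proof (intro allI impI)
  fix X :: "nat \<Rightarrow> plane"
  assume X: "X \<longlonglongrightarrow> 0"
  have [measurable]: "g \<in> borel_measurable borel"
    using g(1) by (rule borel_measurable_continuous_onI)
  from X have "Bseq X" by (intro convergent_imp_Bseq convergentI)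
  then obtain K where K: "\<And>n. norm (X n) \<le> K" by (auto simp: Bseq_def)
  have "(\<lambda>n. LINT x|lborel. (g (x - X n) - g x)\<^sup>2) \<longlonglongrightarrow> 0"
  proof (rule L2_dominated_convergence)
    show "integrable lborel (\<lambda>x::plane. indicator (cball 0 (R + K)) x * (2 * B)\<^sup>2)"
      by (rule integrable_indicator_cball)
    show "AE x in lborel. (\<lambda>n. g (x - X n)) \<longlonglongrightarrow> g x"
    proof (rule AE_I2)
      fix x
      have "isCont g x" using g(1) by (simp add: continuous_on_eq_continuous_at del: split_paired_All)
      moreover have "(\<lambda>n. x - X n) \<longlonglongrightarrow> x" using tendsto_diff[OF tendsto_const X, of x] by simp
      ultimately show "(\<lambda>n. g (x - X n)) \<longlonglongrightarrow> g x" by (rule isCont_tendsto_compose)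
    qed
    show "AE x in lborel. (g (x - X n) - g x)\<^sup>2 \<le> indicator (cball 0 (R + K)) x * (2 * B)\<^sup>2" for n
    proof (rule AE_I2)
      fix x
      show "(g (x - X n) - g x)\<^sup>2 \<le> indicator (cball 0 (R + K)) x * (2 * B)\<^sup>2"
      proof (cases "norm x \<le> R + K")
        case True
        have "\<bar>g (x - X n) - g x\<bar> \<le> \<bar>2 * B\<bar>"
          using g(2)[of x] g(2)[of "x - X n"] by linarith
        then have "(g (x - X n) - g x)\<^sup>2 \<le> (2 * B)\<^sup>2" by (simp only: abs_le_square_iff)
        then show ?thesis using True by simp
      next
        case False
        have "0 \<le> K" using K[of 0] norm_ge_zero order_trans by blast
        moreover have "norm x - K \<le> norm (x - X n)"
          using norm_triangle_ineq2[of x "X n"] K[of n] by linarith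
        ultimately show ?thesis using False g(3)[of x] g(3)[of "x - X n"] by simp
      qed
    qed
  qed measurable
  then show "((\<lambda>y. LINT x|lborel. (g (x - y) - g x)\<^sup>2) \<circ> X) \<longlonglongrightarrow> 0" by (simp add: o_def)
qed

text \<open>Three-term estimate through a continuous \<open>g\<close> close to \<open>f\<close>.
  Translation invariance makes the two outer errors equal, and the factor 3 from squaring a sum of
  three terms accounts for e / 9.\<close>

lemma L2_translate_tendsto:
  fixes f :: "plane \<Rightarrow> real"
  assumes f: "sq_integrable f"
  shows "((\<lambda>y. LINT x|lborel. (f (x - y) - f x)\<^sup>2) \<longlongrightarrow> 0) (at 0)"
proof (rule tendstoI)
  fix e :: real assume e: "0 < e"
  obtain g B R where g: "continuous_on UNIV g" "\<And>x. \<bar>g x\<bar> \<le> B" "\<And>x. R \<le> norm x \<Longrightarrow> g x = 0"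
    and ge: "(LINT x|lborel. (g x - f x)\<^sup>2) < e / 9"
    using sq_integrable_continuous_approx[OF f, of "e / 9"] e by auto
  have [measurable]: "g \<in> borel_measurable borel"
    using g(1) by (rule borel_measurable_continuous_onI)
  note [measurable] = sq_integrable_measurable[OF f]
  have g_L2: "sq_integrable g"
  proof (rule sq_integrable_dominated)
    show "integrable lborel (\<lambda>x::plane. indicator (cball 0 R) x * B\<^sup>2)"
      by (rule integrable_indicator_cball)
    show "(norm (g x))\<^sup>2 \<le> indicator (cball 0 R) x * B\<^sup>2" for x
      using g(2)[of x] g(3)[of x] power_mono[of "\<bar>g x\<bar>" B 2] by (auto simp: indicator_def)
  qed measurable
  note gf = sq_integrable_diff[OF g_L2 f]
  have "\<forall>\<^sub>F y in at 0. (LINT x|lborel. (g (x - y) - g x)\<^sup>2) < e / 9"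
    using e
    by (intro order_tendstoD(2)[OF L2_translate_tendsto_continuous[of g B R, OF g]]) auto
  then show "\<forall>\<^sub>F y in at 0. dist (LINT x|lborel. (f (x - y) - f x)\<^sup>2) 0 < e"
  proof eventually_elim
    case (elim y)
    have i1: "integrable lborel (\<lambda>x. (g (x - y) - f (x - y))\<^sup>2)"
      using sq_integrable_translate[OF gf, of y] by (simp add: sq_integrable_def)
    have i2: "integrable lborel (\<lambda>x. (g (x - y) - g x)\<^sup>2)"
      using sq_integrable_diff[OF sq_integrable_translate[OF g_L2] g_L2, of y] by (simp add: sq_integrable_def)
    have i3: "integrable lborel (\<lambda>x. (g x - f x)\<^sup>2)" using gf by (simp add: sq_integrable_def)
    have "(LINT x|lborel. (f (x - y) - f x)\<^sup>2) \<le>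
      (LINT x|lborel. 3 * (g (x - y) - f (x - y))\<^sup>2 + 3 * (g (x - y) - g x)\<^sup>2 + 3 * (g x - f x)\<^sup>2)"
    proof (rule integral_mono)
      show "integrable lborel (\<lambda>x. (f (x - y) - f x)\<^sup>2)"
        using sq_integrable_diff[OF sq_integrable_translate[OF f] f, of y] by (simp add: sq_integrable_def)
      show "integrable lborel (\<lambda>x. 3 * (g (x - y) - f (x - y))\<^sup>2 + 3 * (g (x - y) - g x)\<^sup>2 + 3 * (g x - f x)\<^sup>2)"
        using i1 i2 i3 by simp
      have "(q - p - r)\<^sup>2 \<le> 3 * p\<^sup>2 + 3 * q\<^sup>2 + 3 * r\<^sup>2" for p q r :: real
        using sum_squares_bound[of q "- p"] sum_squares_bound[of p r] sum_squares_bound[of q "- r"]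
        by (simp add: power2_eq_square algebra_simps)
      from this[of "g (x - y) - g x" "g (x - y) - f (x - y)" "f x - g x" for x]
      show "(f (x - y) - f x)\<^sup>2 \<le> 3 * (g (x - y) - f (x - y))\<^sup>2 + 3 * (g (x - y) - g x)\<^sup>2 + 3 * (g x - f x)\<^sup>2" for x
        by (simp add: power2_commute)
    qed
    also have "\<dots> = 3 * (LINT x|lborel. (g (x - y) - f (x - y))\<^sup>2) + 3 * (LINT x|lborel. (g (x - y) - g x)\<^sup>2)
        + 3 * (LINT x|lborel. (g x - f x)\<^sup>2)"
      using i1 i2 i3 by simp
    also have "(LINT x|lborel. (g (x - y) - f (x - y))\<^sup>2) = (LINT x|lborel. (g x - f x)\<^sup>2)"
      by (rule LINT_translate) measurable
    finally have "(LINT x|lborel. (f (x - y) - f x)\<^sup>2) < e" using elim ge by linarith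
    then show ?case by simp
  qed
qed

text \<open>Its value at 0 is the plain inner product, so an identity of inner products can be
  recovered from one averaged over small translations.\<close>

definition cross_corr :: "(plane \<Rightarrow> real) \<Rightarrow> (plane \<Rightarrow> real) \<Rightarrow> plane \<Rightarrow> real" where
  "cross_corr a f y = (LINT x|lborel. a x * f (x - y))"

lemma isCont_cross_corr_0:
  assumes a: "sq_integrable a" and f: "sq_integrable f"
  shows "isCont (cross_corr a f) 0"
proof -
  have "((\<lambda>y. L2_inner a (\<lambda>x. f (x - y))) \<longlongrightarrow> L2_inner a f) (at 0)"
    using L2_translate_tendsto[OF f]
    by (intro L2_inner_tendsto a f sq_integrable_translate) (simp_all add: L2_inner_def power2_eq_square)
  then show ?thesis by (simp add: isCont_def cross_corr_def[abs_def] L2_inner_def)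
qed

subsection \<open>Smearing\<close>

text \<open>A bump with Lipschitz gradient suffices, and its quadratic Taylor remainder is uniform, so the
  convolution can be differentiated under the integral by a direct estimate.\<close>

definition bump :: "real \<Rightarrow> plane \<Rightarrow> real" where
  "bump r y = (max 0 (r\<^sup>2 - y \<bullet> y))\<^sup>2"

definition bump_grad :: "real \<Rightarrow> plane \<Rightarrow> plane" where
  "bump_grad r y = (- 4 * max 0 (r\<^sup>2 - y \<bullet> y)) *\<^sub>R y"

lemma bump_nonneg: "0 \<le> bump r y"
  by (simp add: bump_def)

lemma bump_outside:
  assumes "0 \<le> r" "r \<le> norm y"
  shows "bump r y = 0" "bump_grad r y = 0"
proof -
  have "r\<^sup>2 \<le> y \<bullet> y"
    using assms power_mono[of r "norm y" 2] by (simp add: power2_norm_eq_inner)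
  then show "bump r y = 0" "bump_grad r y = 0" by (simp_all add: bump_def bump_grad_def)
qed

lemma bump_le: "bump r y \<le> r ^ 4"
proof -
  have "max 0 (r\<^sup>2 - y \<bullet> y) \<le> r\<^sup>2" by simp
  from power_mono[OF this, of 2] show ?thesis
    by (simp add: bump_def flip: power_mult)
qed

lemma norm_bump_grad_le:
  assumes "0 \<le> r"
  shows "norm (bump_grad r y) \<le> 4 * r ^ 3"
proof (cases "r \<le> norm y")
  case True
  then show ?thesis using assms by (simp add: bump_outside)
next
  case False
  have "norm (bump_grad r y) = 4 * max 0 (r\<^sup>2 - y \<bullet> y) * norm y"
    by (simp add: bump_grad_def abs_mult)
  also have "\<dots> \<le> 4 * r\<^sup>2 * r"
    using False assms by (intro mult_mono) auto
  finally show ?thesis by (simp add: power2_eq_square power3_eq_cube)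
qed

lemma continuous_on_bump: "continuous_on UNIV (bump r)"
  and continuous_on_bump_grad: "continuous_on UNIV (bump_grad r)"
  unfolding bump_def bump_grad_def by (intro continuous_intros)+

lemma bump_measurable [measurable]: "bump r \<in> borel_measurable borel"
  and bump_grad_measurable [measurable]: "bump_grad r \<in> borel_measurable borel"
  using continuous_on_bump continuous_on_bump_grad by (auto intro: borel_measurable_continuous_onI)

text \<open>The derivative \<open>2 * max 0 s\<close> of the squared positive part is Lipschitz with
  constant 2, hence the Taylor remainder has constant 1 even across the kink. The proof checks the
  four sign patterns.\<close>

lemma max_0_power2_remainder:
  "\<bar>(max 0 (s + d))\<^sup>2 - (max 0 s)\<^sup>2 - 2 * max 0 s * d\<bar> \<le> (d::real)\<^sup>2"
proof -
  consider "0 \<le> s" "0 \<le> s + d" | "0 \<le> s" "s + d < 0" | "s < 0" "0 \<le> s + d" | "s < 0" "s + d < 0"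
    by linarith
  then show ?thesis
  proof cases
    case 1
    then show ?thesis by (simp add: power2_eq_square algebra_simps)
  next
    case 2
    have "(s + d)\<^sup>2 \<le> d\<^sup>2" using 2 by (intro abs_le_square_iff[THEN iffD1]) auto
    moreover have "- (s\<^sup>2) - 2 * s * d = d\<^sup>2 - (s + d)\<^sup>2" by (simp add: power2_eq_square algebra_simps)
    ultimately show ?thesis using 2 zero_le_power2[of "s + d"] by (simp add: max_def)
  next
    case 3
    have "(s + d)\<^sup>2 \<le> d\<^sup>2" using 3 by (intro power_mono) auto
    then show ?thesis using 3 by (simp add: max_def)
  next
    case 4
    then show ?thesis by (simp add: max_def)
  qed
qed

text \<open>For \<open>norm y < r + 1\<close> and \<open>norm h \<le> 1\<close> the quantity
  \<open>r\<^sup>2 - y \<bullet> y\<close> changes by at most \<open>(2 * r + 3) * norm h\<close>,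
  which gives the first summand; the second comes from the part of that change quadratic in
  \<open>h\<close>.\<close>

definition bump_const :: "real \<Rightarrow> real" where
  "bump_const r = (2 * r + 3)\<^sup>2 + 2 * r\<^sup>2"

lemma bump_remainder:
  assumes r: "0 < r" and h: "norm h \<le> 1"
  shows "\<bar>bump r (y + h) - bump r y - bump_grad r y \<bullet> h\<bar> \<le> bump_const r * (norm h)\<^sup>2"
proof (cases "r + 1 \<le> norm y")
  case True
  have "norm y - norm h \<le> norm (y + h)" using norm_triangle_ineq4[of "y + h" h] by simp
  then have "r \<le> norm (y + h)" "r \<le> norm y" using True h by linarith+
  then show ?thesis using r by (simp add: bump_outside bump_const_def)
next
  case False
  define s where "s = r\<^sup>2 - y \<bullet> y"
  define d where "d = - (2 * (y \<bullet> h) + h \<bullet> h)"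
  have sd: "r\<^sup>2 - (y + h) \<bullet> (y + h) = s + d"
    by (simp add: s_def d_def inner_add_left inner_add_right inner_commute)
  have "\<bar>d\<bar> \<le> 2 * (norm y * norm h) + norm h * norm h"
    using Cauchy_Schwarz_ineq2[of y h] Cauchy_Schwarz_ineq2[of h h] unfolding d_def by linarith
  also have "\<dots> = (2 * norm y + norm h) * norm h" by (simp add: algebra_simps)
  also have "\<dots> \<le> (2 * r + 3) * norm h"
    using False h by (intro mult_right_mono) auto
  finally have "\<bar>d\<bar> \<le> \<bar>(2 * r + 3) * norm h\<bar>" using r by (simp add: abs_mult)
  then have d2: "d\<^sup>2 \<le> (2 * r + 3)\<^sup>2 * (norm h)\<^sup>2"
    by (simp only: abs_le_square_iff power_mult_distrib)
  \<comment> \<open>In \<open>2 * max 0 s * d\<close> the part linear in \<open>h\<close> is the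
    gradient term; the part \<open>- 2 * max 0 s * (h \<bullet> h)\<close> is left over.\<close>
  have "bump r (y + h) - bump r y - bump_grad r y \<bullet> h
      = ((max 0 (s + d))\<^sup>2 - (max 0 s)\<^sup>2 - 2 * max 0 s * d) - 2 * max 0 s * (h \<bullet> h)"
    unfolding bump_def sd bump_grad_def by (simp add: d_def s_def[symmetric] algebra_simps)
  moreover have "\<bar>p - q\<bar> \<le> dd + q" if "\<bar>p\<bar> \<le> dd" "0 \<le> q" for p q dd :: real
    using that by linarith
  ultimately have "\<bar>bump r (y + h) - bump r y - bump_grad r y \<bullet> h\<bar> \<le> d\<^sup>2 + 2 * max 0 s * (h \<bullet> h)"
    using max_0_power2_remainder[of s d] by simp
  also have "\<dots> \<le> (2 * r + 3)\<^sup>2 * (norm h)\<^sup>2 + 2 * r\<^sup>2 * (norm h)\<^sup>2"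
    using d2 by (intro add_mono mult_mono) (auto simp: s_def power2_norm_eq_inner)
  finally show ?thesis by (simp add: bump_const_def algebra_simps)
qed

section \<open>Differentiability and support of bumps and smeared functions\<close>

lemma has_derivative_at_quadratic:
  fixes f :: "'a::real_normed_vector \<Rightarrow> 'b::real_normed_vector"
  assumes D: "bounded_linear D"
    and q: "\<And>h. norm h \<le> 1 \<Longrightarrow> norm (f (x + h) - f x - D h) \<le> K * (norm h)\<^sup>2"
  shows "(f has_derivative D) (at x)"
  unfolding has_derivative_at
proof (rule conjI[OF D Lim_null_comparison])
  show "\<forall>\<^sub>F h in at 0. norm (norm (f (x + h) - f x - D h) / norm h) \<le> K * norm h"
    unfolding eventually_at
  proof (intro exI[of _ 1] conjI ballI impI)
    fix h :: 'a assume h: "h \<noteq> 0 \<and> dist h 0 < 1"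
    then have "norm (f (x + h) - f x - D h) \<le> K * norm h * norm h"
      using q[of h] by (simp add: power2_eq_square mult.assoc)
    then show "norm (norm (f (x + h) - f x - D h) / norm h) \<le> K * norm h"
      using h by (simp add: divide_le_eq)
  qed simp
  show "((\<lambda>h. K * norm h) \<longlongrightarrow> 0) (at (0::'a))"
    by (intro tendsto_mult_right_zero tendsto_norm_zero tendsto_ident_at)
qed

lemma C1_compactly_supported_gradient:
  assumes V: "\<And>x. (f has_derivative (\<lambda>h. V x \<bullet> h)) (at x)"
    and cont: "continuous_on UNIV V" and supp: "\<And>x. R \<le> norm x \<Longrightarrow> f x = 0"
  shows "C1_compactly_supported f" "dx f x = fst (V x)" "dy f x = snd (V x)"
proof -
  have fd: "frechet_derivative f (at x) = (\<lambda>h. V x \<bullet> h)" for x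
    using frechet_derivative_at[OF V] by simp
  have dx: "dx f = (\<lambda>x. fst (V x))" and dy: "dy f = (\<lambda>x. snd (V x))"
    by (auto simp: dx_def dy_def fd inner_prod_def)
  show "dx f x = fst (V x)" "dy f x = snd (V x)" by (simp_all add: dx dy)
  have "{x. f x \<noteq> 0} \<subseteq> cball 0 R"
    using supp by (force simp: not_le intro: less_imp_le)
  then have "bounded {x. f x \<noteq> 0}" using bounded_cball bounded_subset by blast
  moreover have "f differentiable (at x)" for x
    unfolding differentiable_def using V by blast
  ultimately show "C1_compactly_supported f"
    using cont unfolding C1_compactly_supported_def dx dy by (auto intro!: continuous_intros)
qed

lemma C1_compactly_supported_0: "C1_compactly_supported (\<lambda>x. 0)"
  and dx_0: "dx (\<lambda>x. 0) x = 0" and dy_0: "dy (\<lambda>x. 0) x = 0"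
  using C1_compactly_supported_gradient[of "\<lambda>x. 0" "\<lambda>x. 0" 0] by auto

text \<open>The reflected argument \<open>x - z\<close> flips the sign of the gradient and the minus
  sign flips it back, so the gradient of this test function is exactly the kernel of
  \<open>smear_grad\<close>.\<close>

lemma C1_compactly_supported_bump:
  assumes r: "0 < r"
  shows "C1_compactly_supported (\<lambda>z. - bump r (x - z))"
    "dx (\<lambda>z. - bump r (x - z)) z = fst (bump_grad r (x - z))"
    "dy (\<lambda>z. - bump r (x - z)) z = snd (bump_grad r (x - z))"
proof -
  have d: "((\<lambda>z. - bump r (x - z)) has_derivative (\<lambda>h. bump_grad r (x - z) \<bullet> h)) (at z)" for z
  proof (rule has_derivative_at_quadratic)
    show "norm (- bump r (x - (z + h)) - - bump r (x - z) - bump_grad r (x - z) \<bullet> h)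
        \<le> bump_const r * (norm h)\<^sup>2" if "norm h \<le> 1" for h
      using bump_remainder[OF r, of "- h" "x - z"] that
      by (simp add: abs_minus_commute algebra_simps)
  qed (rule bounded_linear_inner_right)
  have c: "continuous_on UNIV (\<lambda>z. bump_grad r (x - z))"
    by (intro continuous_on_compose2[OF continuous_on_bump_grad] continuous_intros) auto
  have s: "- bump r (x - z) = 0" if "norm x + r \<le> norm z" for z
    using bump_outside[of r "x - z"] r that norm_triangle_ineq2[of z x] by (simp add: norm_minus_commute)
  note * = C1_compactly_supported_gradient[OF d c s]
  show "C1_compactly_supported (\<lambda>z. - bump r (x - z))" by (rule *(1))
  show "dx (\<lambda>z. - bump r (x - z)) z = fst (bump_grad r (x - z))" by (rule *(2))
  show "dy (\<lambda>z. - bump r (x - z)) z = snd (bump_grad r (x - z))" by (rule *(3))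
qed

text \<open>The bump is left unnormalised: later only the vanishing of integrals against it is
  exploited, which a constant factor does not affect.\<close>

definition smear :: "real \<Rightarrow> (plane \<Rightarrow> real) \<Rightarrow> plane \<Rightarrow> real" where
  "smear r F x = (LINT z|lborel. bump r (x - z) * F z)"

definition smear_grad :: "real \<Rightarrow> (plane \<Rightarrow> real) \<Rightarrow> plane \<Rightarrow> plane" where
  "smear_grad r F x = (LINT z|lborel. F z *\<^sub>R bump_grad r (x - z))"

lemma integrable_bump_mult:
  assumes F: "integrable lborel F"
  shows "integrable lborel (\<lambda>z. bump r (x - z) * F z)"
proof (rule Bochner_Integration.integrable_bound)
  show "integrable lborel (\<lambda>z. r ^ 4 * F z)" using F by simp
  have [measurable]: "F \<in> borel_measurable borel" using F by auto
  show "(\<lambda>z. bump r (x - z) * F z) \<in> borel_measurable lborel" by measurable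
  show "AE z in lborel. norm (bump r (x - z) * F z) \<le> norm (r ^ 4 * F z)"
    by (auto simp: abs_mult bump_nonneg bump_le intro!: mult_right_mono)
qed

lemma integrable_bump_grad_scaleR:
  assumes F: "integrable lborel F" and r: "0 \<le> r"
  shows "integrable lborel (\<lambda>z. F z *\<^sub>R bump_grad r (x - z))"
proof (rule Bochner_Integration.integrable_bound)
  show "integrable lborel (\<lambda>z. F z * (4 * r ^ 3))" using F by simp
  have [measurable]: "F \<in> borel_measurable borel" using F by auto
  show "(\<lambda>z. F z *\<^sub>R bump_grad r (x - z)) \<in> borel_measurable lborel" by measurable
  show "AE z in lborel. norm (F z *\<^sub>R bump_grad r (x - z)) \<le> norm (F z * (4 * r ^ 3))"
    using r by (auto simp: abs_mult intro!: mult_left_mono norm_bump_grad_le)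
qed

lemma smear_has_derivative:
  assumes F: "integrable lborel F" and r: "0 < r"
  shows "(smear r F has_derivative (\<lambda>h. smear_grad r F x \<bullet> h)) (at x)"
proof (rule has_derivative_at_quadratic)
  fix h :: plane assume h: "norm h \<le> 1"
  note i1 = integrable_bump_mult[OF F, of r] and i2 = integrable_bump_grad_scaleR[OF F less_imp_le[OF r], of x]
  have i3: "integrable lborel (\<lambda>z. (F z *\<^sub>R bump_grad r (x - z)) \<bullet> h)"
    using integrable_inner_left[OF i2] .
  have "smear_grad r F x \<bullet> h = (LINT z|lborel. (F z *\<^sub>R bump_grad r (x - z)) \<bullet> h)"
    unfolding smear_grad_def by (rule integral_inner_left[OF i2, symmetric])
  then have eq: "smear r F (x + h) - smear r F x - smear_grad r F x \<bullet> h
      = (LINT z|lborel. bump r (x + h - z) * F z - bump r (x - z) * F z - (F z *\<^sub>R bump_grad r (x - z)) \<bullet> h)"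
    using i1[of "x + h"] i1[of x] i3 by (simp add: smear_def del: inner_scaleR_left)
  have "norm (smear r F (x + h) - smear r F x - smear_grad r F x \<bullet> h)
      \<le> (LINT z|lborel. norm (bump r (x + h - z) * F z - bump r (x - z) * F z
      - (F z *\<^sub>R bump_grad r (x - z)) \<bullet> h))"
    unfolding eq by (rule Bochner_Integration.integral_norm_bound)
  also have "\<dots> \<le> (LINT z|lborel. bump_const r * (norm h)\<^sup>2 * \<bar>F z\<bar>)"
  proof (rule integral_mono)
    show "norm (bump r (x + h - z) * F z - bump r (x - z) * F z - (F z *\<^sub>R bump_grad r (x - z)) \<bullet> h)
        \<le> bump_const r * (norm h)\<^sup>2 * \<bar>F z\<bar>" for z
    proof -
      have alg: "p * w - q * w - (w *\<^sub>R g) \<bullet> h = (p - q - g \<bullet> h) * w" for p q w :: real and g :: plane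
        by (simp add: left_diff_distrib)
      have xz: "x + h - z = x - z + h" by simp
      show ?thesis
        unfolding alg xz real_norm_def abs_mult by (intro mult_right_mono bump_remainder r h abs_ge_zero)
    qed
    show "integrable lborel (\<lambda>z. norm (bump r (x + h - z) * F z - bump r (x - z) * F z
        - (F z *\<^sub>R bump_grad r (x - z)) \<bullet> h))"
      by (intro integrable_norm Bochner_Integration.integrable_diff i1 i3)
    show "integrable lborel (\<lambda>z. bump_const r * (norm h)\<^sup>2 * \<bar>F z\<bar>)"
      by (intro integrable_mult_right integrable_abs F)
  qed
  finally show "norm (smear r F (x + h) - smear r F x - smear_grad r F x \<bullet> h)
      \<le> bump_const r * (LINT z|lborel. \<bar>F z\<bar>) * (norm h)\<^sup>2"
    by (simp add: mult_ac)
qed (rule bounded_linear_inner_right)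

lemma continuous_on_smear_grad:
  assumes F: "integrable lborel F" and r: "0 \<le> r"
  shows "continuous_on UNIV (smear_grad r F)"
proof -
  have [measurable]: "F \<in> borel_measurable borel" using F by auto
  have "(smear_grad r F \<longlongrightarrow> smear_grad r F x) (at x)" for x
    unfolding tendsto_at_iff_sequentially
  proof (intro allI impI)
    fix X assume X: "X \<longlonglongrightarrow> x"
    have "(\<lambda>n. smear_grad r F (X n)) \<longlonglongrightarrow> smear_grad r F x"
      unfolding smear_grad_def
    proof (rule integral_dominated_convergence)
      show "integrable lborel (\<lambda>z. norm (F z) * (4 * r ^ 3))" using F by simp
      show "AE z in lborel. (\<lambda>n. F z *\<^sub>R bump_grad r (X n - z)) \<longlonglongrightarrow> F z *\<^sub>R bump_grad r (x - z)"
      proof (rule AE_I2)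
        fix z
        have "isCont (bump_grad r) (x - z)"
          using continuous_on_bump_grad by (simp add: continuous_on_eq_continuous_at del: split_paired_All)
        then show "(\<lambda>n. F z *\<^sub>R bump_grad r (X n - z)) \<longlonglongrightarrow> F z *\<^sub>R bump_grad r (x - z)"
          by (intro tendsto_intros isCont_tendsto_compose[of _ "bump_grad r"] X)
      qed
      show "AE z in lborel. norm (F z *\<^sub>R bump_grad r (X n - z)) \<le> norm (F z) * (4 * r ^ 3)" for n
        using r by (auto intro!: mult_left_mono norm_bump_grad_le)
    qed measurable
    then show "(smear_grad r F \<circ> X) \<longlonglongrightarrow> smear_grad r F x" by (simp add: o_def)
  qed
  then show ?thesis by (auto simp: continuous_on_def)
qed

lemma C1_compactly_supported_smear:
  assumes F: "integrable lborel F" and r: "0 < r" and supp: "\<And>z. R \<le> norm z \<Longrightarrow> F z = 0"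
  shows "C1_compactly_supported (smear r F)" "dx (smear r F) x = fst (smear_grad r F x)"
    "dy (smear r F) x = snd (smear_grad r F x)"
proof -
  have s: "smear r F x = 0" if "R + r \<le> norm x" for x
  proof -
    have "bump r (x - z) * F z = 0" for z
      using supp[of z] bump_outside[of r "x - z"] r that norm_triangle_ineq2[of x z] by fastforce
    then have "(\<lambda>z. bump r (x - z) * F z) = (\<lambda>z. 0)" by (rule ext)
    then show ?thesis unfolding smear_def by (simp only:) simp
  qed
  note * = C1_compactly_supported_gradient[OF smear_has_derivative[OF F r]
      continuous_on_smear_grad[OF F less_imp_le[OF r]] s]
  show "C1_compactly_supported (smear r F)" by (rule *(1))
  show "dx (smear r F) x = fst (smear_grad r F x)" by (rule *(2))
  show "dy (smear r F) x = snd (smear_grad r F x)" by (rule *(3))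
qed

section \<open>Integrals against small bumps and products with smeared functions\<close>

lemma integrable_bump: "0 \<le> r \<Longrightarrow> integrable lborel (bump r)"
  by (rule Bochner_Integration.integrable_bound[OF integrable_indicator_cball[of r "r ^ 4"]])
    (auto simp: bump_nonneg bump_le indicator_def bump_outside)

lemma bump_integral_pos:
  assumes r: "0 < r"
  shows "0 < (LINT y|lborel. bump r y)"
proof -
  \<comment> \<open>For \<open>norm y \<le> r / 2\<close> one has
    \<open>r\<^sup>2 - y \<bullet> y \<ge> 3 / 4 * r\<^sup>2\<close>, so the bump is at least
    \<open>?k\<close> there.\<close>
  let ?k = "(3 / 4 * r\<^sup>2)\<^sup>2"
  have "0 < measure lborel (cball (0::plane) (r / 2)) * ?k"
    using r content_cball_pos[of "r / 2" "0::plane"] by simp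
  also have "\<dots> = (LINT y|lborel. indicator (cball (0::plane) (r / 2)) y * ?k)" by simp
  also have "\<dots> \<le> (LINT y|lborel. bump r y)"
  proof (rule integral_mono)
    show "indicator (cball 0 (r / 2)) y * ?k \<le> bump r y" for y :: plane
    proof (cases "norm y \<le> r / 2")
      case True
      then have "y \<bullet> y \<le> r\<^sup>2 / 4"
        using power_mono[OF True, of 2] by (simp add: power2_norm_eq_inner power_divide)
      then have "3 / 4 * r\<^sup>2 \<le> max 0 (r\<^sup>2 - y \<bullet> y)" by (intro max.coboundedI2) linarith
      from power_mono[OF this, of 2] show ?thesis using True by (simp add: bump_def)
    qed (simp add: bump_nonneg)
    show "integrable lborel (\<lambda>y::plane. indicator (cball 0 (r / 2)) y * ?k)"
      by (rule integrable_indicator_cball)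
    show "integrable lborel (bump r)" using r by (simp add: integrable_bump)
  qed
  finally show ?thesis .
qed

text \<open>If \<open>X 0\<close> were positive, \<open>X\<close> would exceed half that value near
  0, and a bump supported there would have a positive integral against it. Applied also to
  \<open>- X\<close>, this turns vanishing averages into a vanishing value.\<close>

lemma bump_integral_zero_imp_nonpos:
  assumes X: "isCont X 0" and \<delta>: "0 < \<delta>"
    and int: "\<And>r. 0 < r \<Longrightarrow> r < \<delta> \<Longrightarrow> integrable lborel (\<lambda>y. bump r y * X y)"
    and zero: "\<And>r. 0 < r \<Longrightarrow> r < \<delta> \<Longrightarrow> (LINT y|lborel. bump r y * X y) = (0::real)"
  shows "X 0 \<le> 0"
proof (rule ccontr)
  assume "\<not> X 0 \<le> 0"
  then have pos: "0 < X 0" by simp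
  have "(X \<longlongrightarrow> X 0) (at 0)" using X by (simp add: isCont_def)
  then have "\<forall>\<^sub>F y in at 0. X 0 / 2 < X y"
    by (rule order_tendstoD(1)) (use pos in simp)
  then obtain d where d: "0 < d" "\<And>y. y \<noteq> 0 \<Longrightarrow> dist y 0 < d \<Longrightarrow> X 0 / 2 < X y"
    by (auto simp: eventually_at)
  define r where "r = min d \<delta> / 2"
  have r: "0 < r" "r < \<delta>" "r < d" using d(1) \<delta> by (auto simp: r_def)
  have "0 < X 0 / 2 * (LINT y|lborel. bump r y)"
    using pos bump_integral_pos[OF r(1)] by simp
  also have "\<dots> = (LINT y|lborel. bump r y * (X 0 / 2))" by simp
  also have "\<dots> \<le> (LINT y|lborel. bump r y * X y)"
  proof (rule integral_mono)
    show "bump r y * (X 0 / 2) \<le> bump r y * X y" for y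
    proof (cases "norm y < r")
      case True
      have "X 0 / 2 \<le> X y"
      proof (cases "y = 0")
        case False
        then show ?thesis using d(2)[of y] True r by (simp add: less_imp_le)
      qed (use pos in simp)
      then show ?thesis by (intro mult_left_mono bump_nonneg)
    next
      case False
      then show ?thesis using r by (simp add: bump_outside)
    qed
  qed (use int r in \<open>auto intro!: integrable_mult_left integrable_bump simp del: times_divide_eq_right\<close>)
  finally show False using zero[OF r(1,2)] by simp
qed

lemma bump_integral_zero_imp_zero:
  assumes X: "isCont X 0" and \<delta>: "0 < \<delta>"
    and int: "\<And>r. 0 < r \<Longrightarrow> r < \<delta> \<Longrightarrow> integrable lborel (\<lambda>y. bump r y * X y)"
    and zero: "\<And>r. 0 < r \<Longrightarrow> r < \<delta> \<Longrightarrow> (LINT y|lborel. bump r y * X y) = (0::real)"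
  shows "X 0 = 0"
proof -
  have "- X 0 \<le> 0"
    using X int zero by (intro bump_integral_zero_imp_nonpos[of "\<lambda>y. - X y", OF _ \<delta>]) auto
  with bump_integral_zero_imp_nonpos[OF assms] show ?thesis by simp
qed

lemma lborel_distr_reflect: "distr lborel borel (\<lambda>y::plane. x - y) = lborel"
  by (subst (2) lborel_affine[of "-1" x]) (auto simp: density_1)

lemma smear_eq:
  assumes [measurable]: "F \<in> borel_measurable borel"
  shows "smear r F x = (LINT y|lborel. bump r y * F (x - y))"
  unfolding smear_def
  by (subst lborel_distr_reflect[of x, symmetric]) (simp add: integral_distr)

text \<open>All three facts come from integrability of \<open>?q\<close> on the product space. There
  the inner integral is at most \<open>bump r y * (?A + ?B)\<close>, with \<open>?A + ?B\<close>
  independent of \<open>y\<close> by translation invariance, and the bump is integrable.\<close>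

lemma
  fixes a f :: "plane \<Rightarrow> real"
  assumes a: "sq_integrable a" and f: "sq_integrable f" and r: "0 \<le> r"
  shows integrable_mult_smear: "integrable lborel (\<lambda>x. a x * smear r f x)"
    and integrable_bump_cross_corr: "integrable lborel (\<lambda>y. bump r y * cross_corr a f y)"
    and integral_mult_smear: "(LINT x|lborel. a x * smear r f x) = (LINT y|lborel. bump r y * cross_corr a f y)"
proof -
  note [measurable] = sq_integrable_measurable[OF a] sq_integrable_measurable[OF f]
  let ?q = "\<lambda>(y, x). bump r y * (a x * f (x - y))"
  have int: "integrable lborel (\<lambda>x. a x * f (x - y))" for y
    using integrable_inner_L2[OF a sq_integrable_translate[OF f], of y] by simp
  let ?A = "LINT x|lborel. (a x)\<^sup>2" and ?B = "LINT x|lborel. (f x)\<^sup>2"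
  have "integrable (lborel \<Otimes>\<^sub>M lborel) ?q"
  proof (rule lborel_pair.Fubini_integrable)
    show "?q \<in> borel_measurable (lborel \<Otimes>\<^sub>M lborel)" by measurable
    show "AE y in lborel. integrable lborel (\<lambda>x. ?q (y, x))" using int by simp
    show "integrable lborel (\<lambda>y. LINT x|lborel. norm (?q (y, x)))"
    proof (rule Bochner_Integration.integrable_bound)
      show "integrable lborel (\<lambda>y. bump r y * (?A + ?B))"
        using integrable_bump[OF r] by simp
      show "AE y in lborel. norm (LINT x|lborel. norm (?q (y, x))) \<le> norm (bump r y * (?A + ?B))"
      proof (rule AE_I2)
        fix y
        have ia: "integrable lborel (\<lambda>x. (a x)\<^sup>2)" and if0: "integrable lborel (\<lambda>x. (f x)\<^sup>2)"
          and iff: "integrable lborel (\<lambda>x. (f (x - y))\<^sup>2)"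
          using a f sq_integrable_translate[OF f, of y] by (auto simp: sq_integrable_def)
        have "(LINT x|lborel. norm (a x * f (x - y))) \<le> (LINT x|lborel. (a x)\<^sup>2 + (f (x - y))\<^sup>2)"
        proof (rule integral_mono)
          show "norm (a x * f (x - y)) \<le> (a x)\<^sup>2 + (f (x - y))\<^sup>2" for x
            using sum_squares_bound[of "\<bar>a x\<bar>" "\<bar>f (x - y)\<bar>"]
              mult_nonneg_nonneg[OF abs_ge_zero abs_ge_zero, of "a x" "f (x - y)"]
            unfolding real_norm_def abs_mult power2_abs by linarith
        qed (use int ia iff in auto)
        also have "\<dots> = ?A + ?B"
          using ia iff by (simp add: LINT_translate(1)[of "\<lambda>x. (f x)\<^sup>2"])
        finally have "bump r y * (LINT x|lborel. norm (a x * f (x - y))) \<le> bump r y * (?A + ?B)"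
          by (intro mult_left_mono bump_nonneg)
        then show "norm (LINT x|lborel. norm (?q (y, x))) \<le> norm (bump r y * (?A + ?B))"
          by (simp add: abs_mult bump_nonneg)
      qed
    qed measurable
  qed
  note q = this
  show "integrable lborel (\<lambda>x. a x * smear r f x)"
    using lborel_pair.integrable_snd[OF q] by (simp add: smear_eq mult.left_commute)
  show "integrable lborel (\<lambda>y. bump r y * cross_corr a f y)"
    using lborel_pair.integrable_fst'[OF q] by (simp add: cross_corr_def)
  have "(LINT x|lborel. a x * smear r f x) = (LINT x|lborel. LINT y|lborel. bump r y * (a x * f (x - y)))"
    by (simp add: smear_eq mult.left_commute)
  also have "\<dots> = (LINT y|lborel. LINT x|lborel. bump r y * (a x * f (x - y)))"
    using lborel_pair.Fubini_integral[OF q] by simp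
  finally show "(LINT x|lborel. a x * smear r f x) = (LINT y|lborel. bump r y * cross_corr a f y)"
    by (simp add: cross_corr_def)
qed

subsection \<open>Pairing weak solutions\<close>

lemma continuous_on_antenna_coords: "continuous_on UNIV (\<lambda>xs. antenna_coords p \<theta> xs 0)"
  unfolding antenna_coords_def by (intro continuous_intros)

lemma antenna_coords_measurable [measurable]:
  "(\<lambda>xs. antenna_coords p \<theta> xs 0) \<in> borel_measurable borel"
  by (rule borel_measurable_continuous_onI[OF continuous_on_antenna_coords])

lemma compact_antenna: "compact (antenna p \<theta> a)"
  unfolding antenna_def
  by (intro compact_continuous_image continuous_on_subset[OF continuous_on_antenna_coords]) auto

text \<open>The source lives on a segment, a null set of the plane, where L2 information says
  nothing; continuity near the antenna takes its place. Compactness leaves a margin \<open>e\<close>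
  within which all translates of the antenna stay in \<open>S\<close>, and there Fubini and
  dominated convergence apply.\<close>

lemma line_source_translates:
  fixes F :: "plane \<Rightarrow> real"
  assumes g [measurable]: "g \<in> borel_measurable borel" and g_le: "\<And>xs. \<bar>g xs\<bar> \<le> C"
    and g_supp: "\<And>xs. xs \<notin> {-a..a} \<Longrightarrow> g xs = 0"
    and F [measurable]: "F \<in> borel_measurable borel"
    and S: "open S" "antenna p \<theta> a \<subseteq> S" and cont: "continuous_on S F"
  obtains e where "0 < e"
    "\<And>r. 0 < r \<Longrightarrow> r < e \<Longrightarrow>
       integrable lborel (\<lambda>y. bump r y * line_source_integral p \<theta> g (\<lambda>x. F (x - y)))"
    "\<And>r. 0 < r \<Longrightarrow> r < e \<Longrightarrow>
       line_source_integral p \<theta> g (smear r F)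
         = (LINT y|lborel. bump r y * line_source_integral p \<theta> g (\<lambda>x. F (x - y)))"
    "isCont (\<lambda>y. line_source_integral p \<theta> g (\<lambda>x. F (x - y))) 0"
proof -
  let ?z = "\<lambda>xs. antenna_coords p \<theta> xs 0"
  obtain e where e: "0 < e" "(\<Union>x\<in>antenna p \<theta> a. cball x e) \<subseteq> S"
    using compact_subset_open_imp_cball_epsilon_subset[OF compact_antenna S] by blast
  \<comment> \<open>The compact set of all antenna points shifted by at most \<open>e\<close>;
    \<open>F\<close> is bounded on it.\<close>
  define Q where "Q = (\<lambda>(x, y). x - y) ` (antenna p \<theta> a \<times> cball (0::plane) e)"
  have "compact Q"
    unfolding Q_def
    by (intro compact_continuous_image compact_Times compact_antenna compact_cball)
      (auto simp: case_prod_unfold intro!: continuous_intros)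
  moreover have QS: "Q \<subseteq> S"
  proof
    fix x assume "x \<in> Q"
    then obtain q y where "q \<in> antenna p \<theta> a" "norm y \<le> e" "x = q - y" by (auto simp: Q_def)
    then have "q \<in> antenna p \<theta> a" "x \<in> cball q e" by (simp_all add: dist_norm)
    then show "x \<in> S" using e(2) by blast
  qed
  ultimately have "bounded (F ` Q)"
    by (intro compact_imp_bounded compact_continuous_image continuous_on_subset[OF cont])
  then obtain B where B: "\<And>x. x \<in> Q \<Longrightarrow> \<bar>F x\<bar> \<le> B"
    by (auto simp: bounded_iff)
  have zQ: "?z xs - y \<in> Q" if "xs \<in> {-a..a}" "norm y \<le> e" for xs y
    unfolding Q_def antenna_def using that by (intro image_eqI[of _ _ "(?z xs, y)"]) auto
  have bound: "\<bar>g xs * F (?z xs - y)\<bar> \<le> C * B * indicator {-a..a} xs" if "norm y \<le> e" for xs y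
  proof (cases "xs \<in> {-a..a}")
    case True
    then show ?thesis
      using mult_mono[OF g_le B[OF zQ[OF True that]]] g_le[of xs] by (simp add: abs_mult)
  next
    case False
    then show ?thesis by (simp add: g_supp)
  qed
  have int: "integrable (lborel \<Otimes>\<^sub>M lborel) (\<lambda>(y, xs). bump r y * (g xs * F (?z xs - y)))"
    if r: "0 < r" "r < e" for r
  proof (rule Bochner_Integration.integrable_bound)
    let ?R = "cball (0::plane) r \<times> {-a..a}"
    have "emeasure (lborel \<Otimes>\<^sub>M lborel) ?R < \<infinity>"
      using emeasure_lborel_cball_finite[of "0::plane" r] emeasure_bounded_finite[of "{-a..a}"]
      by (subst lborel.emeasure_pair_measure_Times) (auto simp: ennreal_mult_less_top)
    moreover have "?R \<in> sets (lborel \<Otimes>\<^sub>M lborel)" by auto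
    ultimately show "integrable (lborel \<Otimes>\<^sub>M lborel) (\<lambda>w. indicator ?R w * (r ^ 4 * (C * B)))"
      by (intro integrable_mult_left integrable_real_indicator)
    show "AE w in lborel \<Otimes>\<^sub>M lborel. norm ((\<lambda>(y, xs). bump r y * (g xs * F (?z xs - y))) w)
        \<le> norm (indicator ?R w * (r ^ 4 * (C * B)))"
    proof (rule AE_I2, clarify)
      fix y xs
      show "norm (bump r y * (g xs * F (?z xs - y))) \<le> norm (indicator ?R (y, xs) * (r ^ 4 * (C * B)))"
      proof (cases "norm y \<le> r \<and> xs \<in> {-a..a}")
        case True
        then have "\<bar>bump r y\<bar> * \<bar>g xs * F (?z xs - y)\<bar> \<le> r ^ 4 * (C * B)"
          using bound[of y xs] r by (intro mult_mono) (auto simp: bump_nonneg bump_le)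
        then show ?thesis using True order_trans[OF _ abs_ge_self] by (simp add: abs_mult[of "bump r y"])
      next
        case False
        then show ?thesis using g_supp[of xs] bump_outside[of r y] r by auto
      qed
    qed
  qed measurable
  show ?thesis
  proof (rule that[OF e(1)])
    fix r assume r: "0 < r" "r < e"
    show "integrable lborel (\<lambda>y. bump r y * line_source_integral p \<theta> g (\<lambda>x. F (x - y)))"
      using lborel_pair.integrable_fst[OF int[OF r]] by (simp add: line_source_integral_def)
    show "line_source_integral p \<theta> g (smear r F)
         = (LINT y|lborel. bump r y * line_source_integral p \<theta> g (\<lambda>x. F (x - y)))"
    proof -
      have "g xs * smear r F (?z xs) = (LINT y|lborel. bump r y * (g xs * F (?z xs - y)))" for xs
        by (simp only: smear_eq[OF F] mult.left_commute[of "bump _ _" "g _"]) simp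
      then have "line_source_integral p \<theta> g (smear r F)
          = (LINT xs|lborel. LINT y|lborel. bump r y * (g xs * F (?z xs - y)))"
        by (simp only: line_source_integral_def)
      also have "\<dots> = (LINT y|lborel. LINT xs|lborel. bump r y * (g xs * F (?z xs - y)))"
        by (rule lborel_pair.Fubini_integral[OF int[OF r]])
      finally show ?thesis by (simp add: line_source_integral_def)
    qed
  next
    let ?L = "\<lambda>y. line_source_integral p \<theta> g (\<lambda>x. F (x - y))"
    \<comment> \<open>The bounds hold only for shifts in this ball; 0 is interior to it, so the
      restricted limit still gives continuity.\<close>
    have "(?L \<longlongrightarrow> ?L 0) (at 0 within cball 0 e)"
      unfolding tendsto_at_iff_sequentially
    proof (intro allI impI)
      fix X :: "nat \<Rightarrow> plane"
      assume Xe: "\<forall>i. X i \<in> cball 0 e - {0}" and X: "X \<longlonglongrightarrow> 0"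
      have "(\<lambda>n. ?L (X n)) \<longlonglongrightarrow> ?L 0"
        unfolding line_source_integral_def
      proof (rule integral_dominated_convergence)
        show "integrable lborel (\<lambda>xs. C * B * indicator {-a..a} xs)"
          using emeasure_bounded_finite[of "{-a..a}"]
          by (intro integrable_mult_right integrable_real_indicator) auto
        show "AE xs in lborel. norm (g xs * F (?z xs - X n)) \<le> C * B * indicator {-a..a} xs" for n
          using bound Xe by (intro AE_I2) auto
        show "AE xs in lborel. (\<lambda>n. g xs * F (?z xs - X n)) \<longlonglongrightarrow> g xs * F (?z xs - 0)"
        proof (rule AE_I2)
          fix xs
          show "(\<lambda>n. g xs * F (?z xs - X n)) \<longlonglongrightarrow> g xs * F (?z xs - 0)"
          proof (cases "xs \<in> {-a..a}")
            case True
            then have "?z xs \<in> S" using S(2) by (auto simp: antenna_def)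
            then have "isCont F (?z xs - 0)" using cont S(1) by (simp add: continuous_on_eq_continuous_at)
            then show ?thesis
              by (intro tendsto_intros isCont_tendsto_compose[of _ F] X)
          next
            case False
            then show ?thesis by (simp add: g_supp)
          qed
        qed
      qed measurable
      then show "(?L \<circ> X) \<longlonglongrightarrow> ?L 0" by (simp add: o_def)
    qed
    then show "isCont ?L 0"
      using e(1) at_within_interior[of "0::plane" "cball 0 e"] by (simp add: isCont_def)
  qed
qed

lemma integrable_sq_integrable_bounded_support:
  fixes F :: "plane \<Rightarrow> real"
  assumes F: "sq_integrable F" and supp: "\<And>x. R \<le> norm x \<Longrightarrow> F x = 0"
  shows "integrable lborel F"
proof (rule Bochner_Integration.integrable_bound)
  show "integrable lborel (\<lambda>x. (F x)\<^sup>2 + indicator (cball 0 R) x * 1)"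
    using F by (intro Bochner_Integration.integrable_add integrable_indicator_cball) (simp add: sq_integrable_def)
  show "F \<in> borel_measurable lborel" using sq_integrable_measurable[OF F] by simp
  show "AE x in lborel. norm (F x) \<le> norm ((F x)\<^sup>2 + indicator (cball 0 R) x * 1)"
  proof (rule AE_I2)
    fix x
    have "\<bar>F x\<bar> \<le> (F x)\<^sup>2 + 1"
      using sum_squares_bound[of "\<bar>F x\<bar>" 1] by (simp add: power2_eq_square)
    then show "norm (F x) \<le> norm ((F x)\<^sup>2 + indicator (cball 0 R) x * 1)"
      using supp[of x] by (cases "norm x \<le> R") auto
  qed
qed

lemma sq_integrable_bounded_mult:
  fixes f :: "plane \<Rightarrow> real"
  assumes f: "sq_integrable f" and [measurable]: "k \<in> borel_measurable borel" and k: "\<And>x. \<bar>k x\<bar> \<le> C"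
  shows "sq_integrable (\<lambda>x. k x * f x)"
proof (rule sq_integrable_dominated)
  note [measurable] = sq_integrable_measurable[OF f]
  show "(\<lambda>x. k x * f x) \<in> borel_measurable borel" by measurable
  show "integrable lborel (\<lambda>x. C\<^sup>2 * (f x)\<^sup>2)" using f by (simp add: sq_integrable_def)
  show "(norm (k x * f x))\<^sup>2 \<le> C\<^sup>2 * (f x)\<^sup>2" for x
    using power_mono[OF k, of x 2] by (simp add: power_mult_distrib mult_right_mono)
qed

lemma sq_integrable_components:
  fixes f :: "plane \<Rightarrow> real \<times> real"
  assumes f: "sq_integrable f"
  shows "sq_integrable (\<lambda>x. fst (f x))" "sq_integrable (\<lambda>x. snd (f x))"
proof -
  note [measurable] = sq_integrable_measurable[OF f]
  have i: "integrable lborel (\<lambda>x. (norm (f x))\<^sup>2)" using f by (simp add: sq_integrable_def)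
  have le: "(fst v)\<^sup>2 \<le> (norm v)\<^sup>2" "(snd v)\<^sup>2 \<le> (norm v)\<^sup>2" for v :: "real \<times> real"
    by (simp_all add: norm_prod_def)
  have m: "(\<lambda>x. fst (f x)) \<in> borel_measurable borel" "(\<lambda>x. snd (f x)) \<in> borel_measurable borel"
    by (rule borel_measurable_continuous_on[where f = fst] borel_measurable_continuous_on[where f = snd];
        intro continuous_intros sq_integrable_measurable[OF f])+
  show "sq_integrable (\<lambda>x. fst (f x))"
    by (rule sq_integrable_dominated[OF _ i]) (simp_all add: le m)
  show "sq_integrable (\<lambda>x. snd (f x))"
    by (rule sq_integrable_dominated[OF _ i]) (simp_all add: le m)
qed

lemma line_source_integral_cong:
  assumes "\<And>xs. xs \<notin> {-a..a} \<Longrightarrow> g xs = 0" "\<And>x. x \<in> antenna p \<theta> a \<Longrightarrow> \<phi> x = k * \<psi> x"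
  shows "line_source_integral p \<theta> g \<phi> = k * line_source_integral p \<theta> g \<psi>"
proof -
  have eq: "g xs * \<phi> (antenna_coords p \<theta> xs 0) = k * (g xs * \<psi> (antenna_coords p \<theta> xs 0))" for xs
    using assms(1)[of xs] assms(2)[of "antenna_coords p \<theta> xs 0"] by (cases "xs \<in> {-a..a}") (auto simp: antenna_def)
  show ?thesis unfolding line_source_integral_def eq by simp
qed

text \<open>The difference of the two sides is the value at \<open>0\<close> of a function \<open>X\<close> of a translation \<open>y\<close>,
  continuous at \<open>0\<close>, where one solution is translated by \<open>y\<close>. Testing the first equation with the smeared
  \<open>c W\<close> and the second with translates of the bump shows that \<open>X\<close> integrates to zero against every
  small bump.\<close>

lemma weak_solution_pairing:
  fixes A W :: "plane \<Rightarrow> real" and K B :: "plane \<Rightarrow> real \<times> real"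
  assumes e1: "\<And>\<phi>. C1_compactly_supported \<phi> \<Longrightarrow>
      L2_inner A (\<lambda>x. \<phi> x / c x) - L2_inner K (\<lambda>x. (dy \<phi> x, - dx \<phi> x))
        = line_source_integral p \<theta> g (\<lambda>x. \<phi> x / c x)"
    and e2: "\<And>\<psi>1 \<psi>2. C1_compactly_supported \<psi>1 \<Longrightarrow> C1_compactly_supported \<psi>2 \<Longrightarrow>
      L2_inner B (\<lambda>x. (\<psi>1 x, \<psi>2 x)) = L2_inner W (\<lambda>x. c x * dy \<psi>1 x - c x * dx \<psi>2 x)"
    and L2: "sq_integrable A" "sq_integrable K" "sq_integrable W" "sq_integrable B"
    and supp: "\<And>x. R \<le> norm x \<Longrightarrow> W x = 0"
    and c [measurable]: "c \<in> borel_measurable borel" and c_bounds: "0 < lo" "\<And>x. lo \<le> c x" "\<And>x. c x \<le> hi"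
    and g: "g \<in> borel_measurable borel" "\<And>xs. \<bar>g xs\<bar> \<le> C" "\<And>xs. xs \<notin> {-a..a} \<Longrightarrow> g xs = 0"
    and S: "open S" "antenna p \<theta> a \<subseteq> S" "continuous_on S W" "\<And>x. x \<in> S \<Longrightarrow> c x = co"
  shows "L2_inner A W + L2_inner K B = line_source_integral p \<theta> g W"
proof -
  \<comment> \<open>Test fields require \<open>c u\<close>, not \<open>u\<close>, to be C1, so
    \<open>c W\<close> is smeared and the compensating 1/c goes to \<open>A\<close>; the product
    \<open>A' x * F x\<close> is again \<open>A x * W x\<close>.\<close>
  define F where "F = (\<lambda>x. c x * W x)"
  define A' where "A' = (\<lambda>x. inverse (c x) * A x)"
  let ?K1 = "\<lambda>x. fst (K x)" and ?K2 = "\<lambda>x. snd (K x)" and ?B1 = "\<lambda>x. fst (B x)" and ?B2 = "\<lambda>x. snd (B x)"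
  have c_pos: "0 < c x" for x using c_bounds(1) c_bounds(2)[of x] by linarith
  have F_L2: "sq_integrable F"
    unfolding F_def using c_pos c_bounds(3) by (intro sq_integrable_bounded_mult L2 c) (simp add: less_imp_le)
  have A'_L2: "sq_integrable A'"
    unfolding A'_def using c_pos c_bounds(1,2)
    by (intro sq_integrable_bounded_mult[where C = "inverse lo"] L2) (auto simp: less_imp_le le_imp_inverse_le)
  have F_0: "F x = 0" if "R \<le> norm x" for x using supp[OF that] by (simp add: F_def)
  have F_int: "integrable lborel F"
    by (rule integrable_sq_integrable_bounded_support[OF F_L2 F_0])
  note K_L2 = sq_integrable_components[OF L2(2)] and B_L2 = sq_integrable_components[OF L2(4)]
  \<comment> \<open>On \<open>S\<close> the wave speed is the constant \<open>co\<close>, so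
    \<open>F\<close> inherits continuity from \<open>W\<close> although \<open>c\<close> may be
    rough elsewhere.\<close>
  have F_cont: "continuous_on S F"
    unfolding F_def using S(3,4) by (subst continuous_on_cong[OF refl, of _ _ "\<lambda>x. co * W x"]) (auto intro!: continuous_intros)
  let ?L = "\<lambda>y. line_source_integral p \<theta> g (\<lambda>x. F (x - y))"
  obtain e where e: "0 < e"
    and L_int: "\<And>r. 0 < r \<Longrightarrow> r < e \<Longrightarrow> integrable lborel (\<lambda>y. bump r y * ?L y)"
    and L_smear: "\<And>r. 0 < r \<Longrightarrow> r < e \<Longrightarrow>
       line_source_integral p \<theta> g (smear r F) = (LINT y|lborel. bump r y * ?L y)"
    and L_cont: "isCont ?L 0"
    using line_source_translates[OF g sq_integrable_measurable[OF F_L2] S(1,2) F_cont] by blast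
  define X where "X = (\<lambda>y. cross_corr A' F y + cross_corr ?K1 ?B1 y + cross_corr ?K2 ?B2 y - inverse co * ?L y)"
  have X_cont: "isCont X 0"
    unfolding X_def by (intro continuous_intros isCont_cross_corr_0 A'_L2 F_L2 K_L2 B_L2 L_cont)
  have X_eq: "bump r y * X y = bump r y * cross_corr A' F y + bump r y * cross_corr ?K1 ?B1 y
      + bump r y * cross_corr ?K2 ?B2 y - inverse co * (bump r y * ?L y)" for r y
    by (simp add: X_def algebra_simps)
  have X_int: "integrable lborel (\<lambda>y. bump r y * X y)" if r: "0 < r" "r < e" for r
    unfolding X_eq using r
    by (intro Bochner_Integration.integrable_add Bochner_Integration.integrable_diff integrable_mult_right
        integrable_bump_cross_corr A'_L2 F_L2 K_L2 B_L2 L_int) auto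
  have X_zero: "(LINT y|lborel. bump r y * X y) = 0" if r: "0 < r" "r < e" for r
  proof -
    have r0: "0 \<le> r" using r by simp
    have sm: "C1_compactly_supported (smear r F)" "dx (smear r F) x = fst (smear_grad r F x)"
      "dy (smear r F) x = snd (smear_grad r F x)" for x
      using C1_compactly_supported_smear[OF F_int r(1), of R] F_0 by blast+
    note bp = C1_compactly_supported_bump[OF r(1)]
    note ig = integrable_bump_grad_scaleR[OF F_int r0]
    \<comment> \<open>The weak field equation says that \<open>B\<close> is (- dy F, dx F) in the
      sense of distributions. Testing with bump translates makes this a pointwise identity for
      smeared functions, here for the first component and below for the second.\<close>
    have dy: "dy (smear r F) x = - smear r ?B1 x" for x
    proof -
      have "dy (smear r F) x = (LINT z|lborel. snd (F z *\<^sub>R bump_grad r (x - z)))"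
        unfolding sm(3) smear_grad_def by (rule integral_bounded_linear[OF bounded_linear_snd ig, symmetric])
      also have "\<dots> = L2_inner W (\<lambda>z. c z * dy (\<lambda>z. - bump r (x - z)) z - c z * dx (\<lambda>z. 0) z)"
        unfolding bp(3) dx_0 by (simp add: L2_inner_def F_def mult_ac)
      also have "\<dots> = L2_inner B (\<lambda>z. (- bump r (x - z), 0))"
        by (rule e2[OF bp(1) C1_compactly_supported_0, symmetric])
      also have "\<dots> = - smear r ?B1 x"
        by (simp add: L2_inner_def inner_prod_def smear_def mult.commute)
      finally show ?thesis .
    qed
    have dx: "- dx (smear r F) x = - smear r ?B2 x" for x
    proof -
      have "dx (smear r F) x = (LINT z|lborel. fst (F z *\<^sub>R bump_grad r (x - z)))"
        unfolding sm(2) smear_grad_def by (rule integral_bounded_linear[OF bounded_linear_fst ig, symmetric])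
      then have "- dx (smear r F) x = L2_inner W (\<lambda>z. c z * dy (\<lambda>z. 0) z - c z * dx (\<lambda>z. - bump r (x - z)) z)"
        unfolding bp(2) dy_0 by (simp add: L2_inner_def F_def mult_ac)
      also have "\<dots> = L2_inner B (\<lambda>z. (0, - bump r (x - z)))"
        by (rule e2[OF C1_compactly_supported_0 bp(1), symmetric])
      also have "\<dots> = - smear r ?B2 x"
        by (simp add: L2_inner_def inner_prod_def smear_def mult.commute)
      finally show ?thesis .
    qed
    have i1: "integrable lborel (\<lambda>x. ?K1 x * smear r ?B1 x)" and i2: "integrable lborel (\<lambda>x. ?K2 x * smear r ?B2 x)"
      by (intro integrable_mult_smear K_L2 B_L2 r0)+
    have "L2_inner A (\<lambda>x. smear r F x / c x) - L2_inner K (\<lambda>x. (- smear r ?B1 x, - smear r ?B2 x))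
        = line_source_integral p \<theta> g (\<lambda>x. smear r F x / c x)"
      using e1[OF sm(1)] unfolding dy dx .
    moreover have "line_source_integral p \<theta> g (\<lambda>x. smear r F x / c x) = inverse co * line_source_integral p \<theta> g (smear r F)"
      using S(2,4) by (intro line_source_integral_cong[OF g(3)]) (auto simp: field_simps)
    moreover have "L2_inner A (\<lambda>x. smear r F x / c x) = (LINT x|lborel. A' x * smear r F x)"
      by (simp add: L2_inner_def A'_def field_simps)
    moreover have "L2_inner K (\<lambda>x. (- smear r ?B1 x, - smear r ?B2 x))
        = - (LINT x|lborel. ?K1 x * smear r ?B1 x) - (LINT x|lborel. ?K2 x * smear r ?B2 x)"
      using i1 i2 by (simp add: L2_inner_def inner_prod_def)
    ultimately have "(LINT x|lborel. A' x * smear r F x) + (LINT x|lborel. ?K1 x * smear r ?B1 x)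
        + (LINT x|lborel. ?K2 x * smear r ?B2 x) = inverse co * (LINT y|lborel. bump r y * ?L y)"
      using L_smear[OF r] by simp
    then have "(LINT y|lborel. bump r y * cross_corr A' F y) + (LINT y|lborel. bump r y * cross_corr ?K1 ?B1 y)
        + (LINT y|lborel. bump r y * cross_corr ?K2 ?B2 y) = inverse co * (LINT y|lborel. bump r y * ?L y)"
      using integral_mult_smear[OF A'_L2 F_L2 r0] integral_mult_smear[OF K_L2(1) B_L2(1) r0]
        integral_mult_smear[OF K_L2(2) B_L2(2) r0] by simp
    then show ?thesis
      unfolding X_eq
      using integrable_bump_cross_corr[OF A'_L2 F_L2 r0] integrable_bump_cross_corr[OF K_L2(1) B_L2(1) r0]
        integrable_bump_cross_corr[OF K_L2(2) B_L2(2) r0] L_int[OF r] by simp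
  qed
  have "X 0 = 0"
    by (rule bump_integral_zero_imp_zero[OF X_cont e X_int X_zero])
  moreover have "cross_corr A' F 0 = L2_inner A W"
  proof -
    have "A' x * F x = A x * W x" for x using c_pos[of x] by (simp add: A'_def F_def)
    then show ?thesis by (simp add: cross_corr_def L2_inner_def)
  qed
  moreover have "cross_corr ?K1 ?B1 0 + cross_corr ?K2 ?B2 0 = L2_inner K B"
    using integrable_inner_L2[OF K_L2(1) B_L2(1)] integrable_inner_L2[OF K_L2(2) B_L2(2)]
    by (simp add: cross_corr_def L2_inner_def inner_prod_def)
  moreover have "line_source_integral p \<theta> g W = inverse co * ?L 0"
    unfolding diff_zero
  proof (rule line_source_integral_cong[OF g(3)])
    fix x assume "x \<in> antenna p \<theta> a"
    then have "c x = co" using S(2,4) by blast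
    then show "W x = inverse co * F x" using c_pos[of x] by (simp add: F_def)
  qed
  ultimately show ?thesis by (simp add: X_def)
qed

text \<open>The scalar test component is divided by \<open>c\<close>, so that its product with
  \<open>c\<close> is \<phi>; it is admissible without smoothness of \<open>c\<close>.\<close>

lemma wave_equation_test_scalar:
  assumes eq: "\<And>w. test_field c w \<Longrightarrow>
      pair_inner (A, B) w - pair_inner (U, K) (wave_op c w) = line_source_integral p \<theta> g (fst w)"
    and c: "\<And>x. c x \<noteq> 0" and \<phi>: "C1_compactly_supported \<phi>"
  shows "L2_inner A (\<lambda>x. \<phi> x / c x) - L2_inner K (\<lambda>x. (dy \<phi> x, - dx \<phi> x))
      = line_source_integral p \<theta> g (\<lambda>x. \<phi> x / c x)"
proof -
  let ?w = "(\<lambda>x. \<phi> x / c x, \<lambda>x. (0, 0)) :: field_pair"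
  have "test_field c ?w"
    using \<phi> c by (simp add: test_field_def C1_compactly_supported_0)
  from eq[OF this] show ?thesis
    using c by (simp add: pair_inner_def wave_op_def dx_0 dy_0 L2_inner_def flip: zero_prod_def)
qed

text \<open>The source acts only on the scalar component, so a test field with zero scalar part sees
  no source.\<close>

lemma wave_equation_test_field:
  assumes eq: "\<And>w. test_field c w \<Longrightarrow>
      pair_inner (A, B) w - pair_inner (U, K) (wave_op c w) = line_source_integral p \<theta> g (fst w)"
    and \<psi>: "C1_compactly_supported \<psi>1" "C1_compactly_supported \<psi>2"
  shows "L2_inner B (\<lambda>x. (\<psi>1 x, \<psi>2 x)) = L2_inner U (\<lambda>x. c x * dy \<psi>1 x - c x * dx \<psi>2 x)"
proof -
  let ?w = "(\<lambda>x. 0, \<lambda>x. (\<psi>1 x, \<psi>2 x)) :: field_pair"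
  have "test_field c ?w"
    using \<psi> by (simp add: test_field_def C1_compactly_supported_0)
  from eq[OF this] show ?thesis
    by (simp add: pair_inner_def wave_op_def dx_0 dy_0 L2_inner_def line_source_integral_def flip: zero_prod_def)
qed

subsection \<open>Integration along characteristics\<close>

lemma L2_inner_zero [simp]: "L2_inner (\<lambda>x. 0) g = 0" "L2_inner f (\<lambda>x. 0) = 0"
  by (simp_all add: L2_inner_def)

text \<open>Bridge from the interval integral of the fundamental theorem to the Lebesgue integral
  over the line in which the data are expressed.\<close>

lemma integral_eq_if_has_integral_zero_outside:
  fixes f :: "real \<Rightarrow> real"
  assumes f: "integrable lborel f" and I: "(f has_integral I) S" and 0: "\<And>x. x \<notin> S \<Longrightarrow> f x = 0"
  shows "I = (LINT x|lborel. f x)"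
  using has_integral_on_superset[OF I 0 subset_UNIV] has_integral_integral_lborel[OF f] has_integral_unique
  by blast

text \<open>The argument in time, isolated from space: the operator, the medium and the antenna
  enter only through \<open>pairing\<close> and the conditions on \<open>j\<close>, where
  \<open>j t s\<close> stands for the source at time \<open>t\<close> paired with the wave at time
  \<open>s\<close>.\<close>

locale source_pairing =
  fixes U ut :: "real \<Rightarrow> plane \<Rightarrow> real" and K Kt :: "real \<Rightarrow> plane \<Rightarrow> real \<times> real"
    and j :: "real \<Rightarrow> real \<Rightarrow> real" and D :: "real \<Rightarrow> real" and T0 :: real
  assumes U: "\<And>t. L2_deriv U (ut t) t" and K: "\<And>t. L2_deriv K (Kt t) t"
    and pairing: "\<And>t s. L2_inner (ut t) (U s) + L2_inner (K t) (Kt s) = j t s"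
    and quiet: "\<And>t. t < - T0 \<Longrightarrow> U t = (\<lambda>x. 0)" "\<And>t. t < - T0 \<Longrightarrow> K t = (\<lambda>x. 0)"
    and j_support: "\<And>t s. T0 < \<bar>t\<bar> \<Longrightarrow> j t s = 0"
    and j_even: "\<And>t s. j (- t) s = j t s"
    and j_int: "\<And>d. integrable lborel (\<lambda>q. j q (d - q))"
    and j_data: "\<And>d. (LINT q|lborel. j q (d - q)) = D d"
begin

text \<open>One formula serves both directions: \<sigma> = 1 for the sum and \<sigma> = -1 for the
  difference of the two products. In both cases \<sigma>^2 = 1, so the terms regroup into two
  instances of \<open>pairing\<close>.\<close>

lemma derivative_along:
  assumes \<sigma>: "\<sigma> \<noteq> 0"
  shows "((\<lambda>r. L2_inner (U (t + r)) (U (s + \<sigma> * r)) + \<sigma> * L2_inner (K (t + r)) (K (s + \<sigma> * r)))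
    has_real_derivative L2_inner (ut (t + r)) (U (s + \<sigma> * r)) + \<sigma> * L2_inner (U (t + r)) (ut (s + \<sigma> * r))
      + \<sigma> * (L2_inner (Kt (t + r)) (K (s + \<sigma> * r)) + \<sigma> * L2_inner (K (t + r)) (Kt (s + \<sigma> * r)))) (at r)"
proof -
  have "L2_deriv (\<lambda>r. U (t + r)) (ut (t + r)) r" "L2_deriv (\<lambda>r. K (t + r)) (Kt (t + r)) r"
    using L2_deriv_affine[of U "ut (t + r)" t 1 r] L2_deriv_affine[of K "Kt (t + r)" t 1 r] U K by simp_all
  note d = L2_deriv_inner[OF this(1) L2_deriv_affine[OF U \<sigma>, of s]]
    L2_deriv_inner[OF this(2) L2_deriv_affine[OF K \<sigma>, of s]]
  from DERIV_add[OF d(1) DERIV_cmult[OF d(2), of \<sigma>]] show ?thesis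
    by (simp only: L2_inner_scaleR_right)
qed

lemma derivative_diagonal:
  "((\<lambda>r. L2_inner (U (t + r)) (U (s + r)) + L2_inner (K (t + r)) (K (s + r)))
    has_real_derivative j (t + r) (s + r) + j (s + r) (t + r)) (at r)"
  using pairing[of "t + r" "s + r"] pairing[of "s + r" "t + r"]
    L2_inner_commute[of "U (t + r)" "ut (s + r)"] L2_inner_commute[of "Kt (t + r)" "K (s + r)"]
  by (intro DERIV_cong[OF derivative_along[of 1 t s r, simplified]]) simp

lemma derivative_antidiagonal:
  "((\<lambda>r. L2_inner (U (t + r)) (U (s - r)) - L2_inner (K (t + r)) (K (s - r)))
    has_real_derivative j (t + r) (s - r) - j (s - r) (t + r)) (at r)"
  using pairing[of "t + r" "s - r"] pairing[of "s - r" "t + r"]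
    L2_inner_commute[of "U (t + r)" "ut (s - r)"] L2_inner_commute[of "Kt (t + r)" "K (s - r)"]
  by (intro DERIV_cong[OF derivative_along[of "-1" t s r, simplified]]) simp

text \<open>Evenness enters here: replacing \<open>q\<close> by \<open>- q\<close> turns the
  antidiagonal integral of the data into a diagonal one.\<close>

lemma j_data': "integrable lborel (\<lambda>q. j q (q + d))" "(LINT q|lborel. j q (q + d)) = D d"
proof -
  have eq: "j (0 + - 1 * q) ((0 + - 1 * q) + d) = j q (d - q)" for q
    by (simp add: j_even)
  show "integrable lborel (\<lambda>q. j q (q + d))"
    using j_int[of d] lborel_integrable_real_affine_iff[of "-1" "\<lambda>q. j q (q + d)" 0] unfolding eq by simp
  show "(LINT q|lborel. j q (q + d)) = D d"
    using j_data[of d] lborel_integral_real_affine[of "-1" "\<lambda>q. j q (q + d)" 0] unfolding eq by simp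
qed

lemma j_diagonal: "integrable lborel (\<lambda>r. j (t + r) (s + r))" "(LINT r|lborel. j (t + r) (s + r)) = D (s - t)"
proof -
  have eq: "j (t + 1 * r) ((t + 1 * r) + (s - t)) = j (t + r) (s + r)" for r
    by (simp add: add.commute)
  show "integrable lborel (\<lambda>r. j (t + r) (s + r))"
    using j_data'(1)[of "s - t"] lborel_integrable_real_affine_iff[of 1 "\<lambda>q. j q (q + (s - t))" t] unfolding eq by simp
  show "(LINT r|lborel. j (t + r) (s + r)) = D (s - t)"
    using j_data'(2)[of "s - t"] lborel_integral_real_affine[of 1 "\<lambda>q. j q (q + (s - t))" t] unfolding eq by simp
qed

lemma j_antidiagonal: "integrable lborel (\<lambda>r. j (s - r) (t + r))" "(LINT r|lborel. j (s - r) (t + r)) = D (t + s)"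
proof -
  have eq: "j (s + - 1 * r) (t + s - (s + - 1 * r)) = j (s - r) (t + r)" for r
    by simp
  show "integrable lborel (\<lambda>r. j (s - r) (t + r))"
    using j_int[of "t + s"] lborel_integrable_real_affine_iff[of "-1" "\<lambda>q. j q (t + s - q)" s] unfolding eq by simp
  show "(LINT r|lborel. j (s - r) (t + r)) = D (t + s)"
    using j_data[of "t + s"] lborel_integral_real_affine[of "-1" "\<lambda>q. j q (t + s - q)" s] unfolding eq by simp
qed

lemma sum_eq_data:
  assumes "T0 < t" "T0 < s"
  shows "L2_inner (U t) (U s) + L2_inner (K t) (K s) = D (s - t) + D (t - s)"
proof -
  \<comment> \<open>Large enough that \<open>t - R\<close> and \<open>s - R\<close> both precede
    \<open>- T0\<close>, where the wave vanishes.\<close>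
  define R where "R = \<bar>t\<bar> + \<bar>s\<bar> + \<bar>T0\<bar> + 1"
  let ?E = "\<lambda>r. L2_inner (U (t + r)) (U (s + r)) + L2_inner (K (t + r)) (K (s + r))"
  let ?f = "\<lambda>r. j (t + r) (s + r) + j (s + r) (t + r)"
  have "(?f has_integral ?E 0 - ?E (- R)) {- R..0}"
    by (intro fundamental_theorem_of_calculus)
      (auto simp: R_def has_real_derivative_iff_has_vector_derivative[symmetric]
        intro: has_field_derivative_at_within derivative_diagonal)
  moreover have "?E (- R) = 0"
    using quiet[of "t + - R"] by (simp add: R_def)
  moreover have "?f r = 0" if "r \<notin> {- R..0}" for r
  proof -
    \<comment> \<open>For positive \<open>r\<close> both times lie after the source by assumption;
      for \<open>r < - R\<close> both lie before it.\<close>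
    have "T0 < \<bar>t + r\<bar>" "T0 < \<bar>s + r\<bar>" using that assms by (auto simp: R_def)
    then show ?thesis by (simp add: j_support)
  qed
  moreover have "integrable lborel ?f"
    by (intro Bochner_Integration.integrable_add j_diagonal)
  ultimately have "?E 0 = (LINT r|lborel. ?f r)"
    by (intro integral_eq_if_has_integral_zero_outside[of ?f _ "{- R..0}"]) auto
  then show ?thesis by (simp add: j_diagonal)
qed

lemma difference_eq_data:
  assumes "T0 < t" "T0 < s"
  shows "L2_inner (U t) (U s) - L2_inner (K t) (K s) = D (t + s)"
proof -
  define R where "R = \<bar>t\<bar> + \<bar>s\<bar> + \<bar>T0\<bar> + 1"
  let ?E = "\<lambda>r. L2_inner (U (t + r)) (U (s - r)) - L2_inner (K (t + r)) (K (s - r))"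
  let ?f = "\<lambda>r. j (s - r) (t + r)"
  have "((\<lambda>r. j (t + r) (s - r) - ?f r) has_integral ?E R - ?E 0) {0..R}"
    by (intro fundamental_theorem_of_calculus)
      (auto simp: R_def has_real_derivative_iff_has_vector_derivative[symmetric]
        intro: has_field_derivative_at_within derivative_antidiagonal)
  moreover have "?E R = 0"
    using quiet[of "s - R"] by (simp add: R_def)
  \<comment> \<open>Moving along the antidiagonal, the first time only grows beyond
    \<open>T0\<close>, so its source term is absent; the second time sweeps over the whole source
    interval.\<close>
  moreover have "j (t + r) (s - r) - ?f r = - ?f r" if "r \<in> {0..R}" for r
    using that assms j_support[of "t + r" "s - r"] by auto
  ultimately have "((\<lambda>r. - ?f r) has_integral - ?E 0) {0..R}"
    using has_integral_cong[of "{0..R}" "\<lambda>r. j (t + r) (s - r) - ?f r" "\<lambda>r. - ?f r"] by simp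
  from has_integral_neg[OF this] have "(?f has_integral ?E 0) {0..R}"
    by simp
  moreover have "?f r = 0" if "r \<notin> {0..R}" for r
  proof -
    have "T0 < \<bar>s - r\<bar>" using that assms by (auto simp: R_def)
    then show ?thesis by (simp add: j_support)
  qed
  ultimately have "?E 0 = (LINT r|lborel. ?f r)"
    using j_antidiagonal(1) by (intro integral_eq_if_has_integral_zero_outside[of ?f _ "{0..R}"]) auto
  then show ?thesis by (simp add: j_antidiagonal)
qed

lemma inner_eq_data:
  assumes "T0 < t" "T0 < s"
  shows "L2_inner (U t) (U s) = 1/2 * (D (s - t) + D (t - s)) + 1/2 * D (t + s)"
proof -
  have "p = 1/2 * d + 1/2 * e" if "p + q = d" "p - q = e" for p q d e :: real
    using that by (simp add: field_simps)
  then show ?thesis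
    using sum_eq_data[OF assms] difference_eq_data[OF assms] .
qed

end

section \<open>From source pairings to data and matrices\<close>

lemma line_source_time_integral:
  fixes b :: "real \<Rightarrow> real \<Rightarrow> real" and u :: "plane \<Rightarrow> real \<Rightarrow> real"
  assumes b_meas: "(\<lambda>(xs, t). b xs t) \<in> borel_measurable borel"
    and b_le: "\<And>xs t. \<bar>b xs t\<bar> \<le> C"
    and b_antenna: "\<And>xs t. xs \<notin> {-a..a} \<Longrightarrow> b xs t = 0"
    and b_time: "\<And>xs t. t \<notin> {-Tb..Tb} \<Longrightarrow> b xs t = 0"
    and b_even: "\<And>xs t. b xs (- t) = b xs t"
    and u_cont: "continuous_on (S \<times> UNIV) (\<lambda>(x, t). u x t)" and S: "antenna p \<theta> a \<subseteq> S"
  shows "integrable lborel (\<lambda>q. line_source_integral p \<theta> (\<lambda>xs. b xs q) (\<lambda>x. u x (d - q)))"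
    "(LINT q|lborel. line_source_integral p \<theta> (\<lambda>xs. b xs q) (\<lambda>x. u x (d - q))) = data p \<theta> b Tb u d"
proof -
  let ?z = "\<lambda>xs. antenna_coords p \<theta> xs 0"
  let ?A = "{-a..a} \<times> {-Tb..Tb} :: (real \<times> real) set"
  let ?v = "\<lambda>w. u (?z (fst w)) (d - snd w)"
  have z_cont: "continuous_on ?A (\<lambda>w. ?z (fst w))"
    by (rule continuous_on_compose2[OF continuous_on_antenna_coords]) (auto intro: continuous_intros)
  have v_cont: "continuous_on ?A ?v"
  proof -
    have "continuous_on ?A (\<lambda>w. (\<lambda>(x, t). u x t) (?z (fst w), d - snd w))"
      using S by (intro continuous_on_compose2[OF u_cont] continuous_on_Pair z_cont continuous_intros)
        (auto simp: antenna_def)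
    then show ?thesis by simp
  qed
  have A: "compact ?A" by (intro compact_Times compact_Icc)
  then have "bounded (?v ` ?A)" by (intro compact_imp_bounded compact_continuous_image v_cont)
  then obtain B where "\<forall>r \<in> ?v ` ?A. norm r \<le> B"
    unfolding bounded_iff by blast
  then have B: "\<bar>?v w\<bar> \<le> B" if "w \<in> ?A" for w
    using imageI[OF that, of ?v] unfolding real_norm_def by (rule bspec)
  let ?f = "\<lambda>(xs, q). b xs q * u (?z xs) (d - q)"
  \<comment> \<open>Continuity of \<open>u\<close> is known only on \<open>S \<times> UNIV\<close>.
    Inserting the indicator of the compact rectangle carrying \<open>b\<close> makes the wave factor
    measurable on the whole plane.\<close>
  have f_eq: "?f = (\<lambda>w. (\<lambda>(xs, t). b xs t) w * (indicator ?A w *\<^sub>R ?v w))"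
  proof (rule ext, clarify)
    fix xs q
    show "b xs q * u (?z xs) (d - q) = b xs q * (indicator ?A (xs, q) *\<^sub>R ?v (xs, q))"
      using b_antenna[of xs q] b_time[of q xs] by (cases "(xs, q) \<in> ?A") auto
  qed
  have "integrable lborel ?f"
  proof (rule Bochner_Integration.integrable_bound)
    show "integrable lborel (\<lambda>w. indicator ?A w * (C * B))"
      using A emeasure_compact_finite[OF A] by (intro integrable_mult_left integrable_real_indicator) (auto intro: borel_compact)
    have "(\<lambda>w. indicator ?A w *\<^sub>R ?v w) \<in> borel_measurable borel"
      by (intro borel_measurable_continuous_on_indicator v_cont borel_compact A)
    then have "?f \<in> borel_measurable borel"
      unfolding f_eq using b_meas by (intro borel_measurable_times)
    then show "?f \<in> borel_measurable lborel" by simp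
    show "AE w in lborel. norm (?f w) \<le> norm (indicator ?A w * (C * B))"
    proof (rule AE_I2)
      fix w
      show "norm (?f w) \<le> norm (indicator ?A w * (C * B))"
      proof (cases "w \<in> ?A")
        case True
        obtain xs q where w: "w = (xs, q)" by (cases w)
        have "\<bar>b xs q\<bar> * \<bar>?v w\<bar> \<le> C * B"
          using b_le[of xs q] B[OF True] by (intro mult_mono) auto
        then show ?thesis using True order_trans[OF _ abs_ge_self] by (simp add: w abs_mult[of "b xs q"])
      next
        case False
        then show ?thesis by (simp add: f_eq)
      qed
    qed
  qed
  then have f_int: "integrable (lborel \<Otimes>\<^sub>M lborel) ?f" by (simp add: lborel_prod)
  let ?j = "\<lambda>q. line_source_integral p \<theta> (\<lambda>xs. b xs q) (\<lambda>x. u x (d - q))"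
  show "integrable lborel ?j"
    using lborel_pair.integrable_snd[OF f_int] by (simp add: line_source_integral_def)
  have "(LINT q|lborel. ?j q) = (LINT xs|lborel. LINT q|lborel. b xs q * u (?z xs) (d - q))"
    using lborel_pair.Fubini_integral[OF f_int] by (simp add: line_source_integral_def)
  also have "\<dots> = data p \<theta> b Tb u d"
  proof -
    \<comment> \<open>Evenness removes the sign in the time argument of \<open>data\<close>, and the
      time support of \<open>b\<close> permits the restriction to the interval.\<close>
    have "b xs q * u (?z xs) (d - q) = indicator {-Tb..Tb} q *\<^sub>R (b xs (- q) * u (?z xs) (d - q))" for xs q
      using b_time[of q xs] by (auto simp: b_even indicator_def)
    then show ?thesis by (simp only: data_def set_lebesgue_integral_def)
  qed
  finally show "(LINT q|lborel. ?j q) = data p \<theta> b Tb u d" .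
qed

lemma C1_in_time_L2_deriv: "C1_in_time f f' \<Longrightarrow> L2_deriv (\<lambda>t x. f x t) (\<lambda>x. f' x t) t"
  by (simp add: C1_in_time_def L2_deriv_def)

lemma gramian_toeplitz_hankel:
  assumes G: "\<And>m j. m < M \<Longrightarrow> j < M \<Longrightarrow>
      L2_inner (v m) (v j) = \<phi> (int m - int j) + \<psi> (m + j)"
  shows "\<exists>A B. A \<in> carrier_mat M M \<and> B \<in> carrier_mat M M \<and> toeplitz A \<and> hankel B \<and> gramian M v = A + B"
proof (intro exI conjI)
  let ?A = "Matrix.mat M M (\<lambda>(i, j). \<phi> (int i - int j))" and ?B = "Matrix.mat M M (\<lambda>(i, j). \<psi> (i + j))"
  show "toeplitz ?A" unfolding toeplitz_def by (intro exI[of _ \<phi>]) simp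
  show "hankel ?B" unfolding hankel_def by (intro exI[of _ \<psi>]) simp
  show "gramian M v = ?A + ?B" using G by (intro eq_matI) (auto simp: gramian_def)
qed auto

lemma transpose_gramian: "transpose_mat (gramian M v) = gramian M v"
  by (rule eq_matI) (auto simp: gramian_def L2_inner_commute)

lemma wave_speed_bounds:
  assumes mu: "0 < \<mu>" and eps: "0 < lo" "\<And>x. lo \<le> \<epsilon> x" "\<And>x. \<epsilon> x \<le> hi"
  shows "0 < 1 / sqrt (\<mu> * hi)" "1 / sqrt (\<mu> * hi) \<le> wave_speed \<mu> \<epsilon> x"
    "wave_speed \<mu> \<epsilon> x \<le> 1 / sqrt (\<mu> * lo)"
proof -
  have hi: "0 < hi" using eps(1) eps(2)[of x] eps(3)[of x] by linarith
  have ex: "0 < \<epsilon> x" using eps(1) eps(2)[of x] by linarith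
  show "0 < 1 / sqrt (\<mu> * hi)" using mu hi by simp
  show "1 / sqrt (\<mu> * hi) \<le> wave_speed \<mu> \<epsilon> x" "wave_speed \<mu> \<epsilon> x \<le> 1 / sqrt (\<mu> * lo)"
    unfolding wave_speed_def using mu hi ex eps(1) eps(2,3)[of x]
    by (auto intro!: divide_left_mono real_sqrt_le_mono mult_left_mono mult_pos_pos)
qed

theorem theorem1:
  fixes \<mu> \<epsilon>\<^sub>o \<theta> a T\<^sub>b T \<tau> :: real
    and \<epsilon> :: "plane \<Rightarrow> real"
    and \<Omega> :: "plane set"
    and p :: plane
    and b :: "real \<Rightarrow> real \<Rightarrow> real"
    and u :: "plane \<Rightarrow> real \<Rightarrow> real"
    and H :: "plane \<Rightarrow> real \<Rightarrow> real \<times> real"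
    and M :: nat
    and G :: "real Matrix.mat"
  assumes mu: "0 < \<mu>"
    and eps_o: "0 < \<epsilon>\<^sub>o"
    and imaging_domain: "compact \<Omega>"
    and eps_outside: "\<And>x. x \<notin> \<Omega> \<Longrightarrow> \<epsilon> x = \<epsilon>\<^sub>o"
    and eps_measurable: "\<epsilon> \<in> borel_measurable borel"
    and eps_bounds: "\<exists>lo>0. \<exists>hi. \<forall>x. lo \<le> \<epsilon> x \<and> \<epsilon> x \<le> hi"
    and antenna_away: "0 < setdist (antenna p \<theta> a) \<Omega>"
    and b_measurable: "(\<lambda>(xs, t). b xs t) \<in> borel_measurable borel"
    and b_bounded: "\<exists>B. \<forall>xs t. \<bar>b xs t\<bar> \<le> B"
    and b_antenna: "\<And>xs t. xs \<notin> {-a..a} \<Longrightarrow> b xs t = 0"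
    and b_time: "\<And>xs t. t \<notin> {-T\<^sub>b..T\<^sub>b} \<Longrightarrow> b xs t = 0"
    and b_even: "\<And>xs t. b xs (- t) = b xs t"
    and T\<^sub>b_pos: "0 < T\<^sub>b"
    and wave: "wave_equation (wave_speed \<mu> \<epsilon>) p \<theta> b u H"
    and quiescent: "\<And>x t. t < - T\<^sub>b \<Longrightarrow> u x t = 0 \<and> H x t = 0"
    and finite_speed: "\<And>R. bounded {x. \<exists>t\<in>{-R..R}. u x t \<noteq> 0 \<or> H x t \<noteq> 0}"
    and u_continuous: "continuous_on ((- \<Omega>) \<times> UNIV) (\<lambda>(x, t). u x t)"
    and T_def: "T = travel_time_offset (1 / sqrt (\<mu> * \<epsilon>\<^sub>o)) \<Omega> (source_support p \<theta> b) T\<^sub>b"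
    and T_large: "T\<^sub>b < T"
    and tau: "0 < \<tau>"
    and M: "1 \<le> M"
    and G_def: "G = gramian M (snapshot u \<tau> T)"
  shows "transpose_mat G = G
    \<and> (\<exists>A B. A \<in> carrier_mat M M \<and> B \<in> carrier_mat M M \<and>
             toeplitz A \<and> hankel B \<and> G = A + B)
    \<and> (\<forall>m j. m \<le> M - 1 \<and> j \<le> M - 1 - m \<longrightarrow>
         G $$ (m, m + j) =
           1/2 * (data p \<theta> b T\<^sub>b u (real j * \<tau>) + data p \<theta> b T\<^sub>b u (- (real j * \<tau>)))
           + 1/2 * data p \<theta> b T\<^sub>b u (2 * T + (2 * real m + real j) * \<tau>))"
proof -
  define c where "c = wave_speed \<mu> \<epsilon>"
  obtain lo hi where eps: "0 < lo" "\<And>x. lo \<le> \<epsilon> x" "\<And>x. \<epsilon> x \<le> hi"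
    using eps_bounds by blast
  have c_meas: "c \<in> borel_measurable borel"
    using eps_measurable unfolding c_def wave_speed_def by measurable
  note c_bounds = wave_speed_bounds[of \<mu> lo \<epsilon> hi, OF mu eps, folded c_def]
  have c_out: "c x = 1 / sqrt (\<mu> * \<epsilon>\<^sub>o)" if "x \<in> - \<Omega>" for x
    using eps_outside[of x] that by (simp add: c_def wave_speed_def)
  \<comment> \<open>The complement of the imaging domain is the open neighbourhood of the antenna on
    which \<open>u\<close> is continuous and \<open>c\<close> is constant.\<close>
  have S: "open (- \<Omega>)" "antenna p \<theta> a \<subseteq> - \<Omega>"
    using compact_imp_closed[OF imaging_domain] antenna_away
    by (auto simp: open_Compl dest: setdist_eq_0I)
  obtain C where b_le: "\<And>xs t. \<bar>b xs t\<bar> \<le> C" using b_bounded by blast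
  have b_slice: "(\<lambda>xs. b xs t) \<in> borel_measurable borel" for t
    using measurable_compose[OF measurable_Pair2' b_measurable[unfolded borel_prod[symmetric]], of t] by simp
  obtain ut Ht where C1: "C1_in_time u ut" "C1_in_time H Ht"
    and weak_all: "\<forall>t w. test_field c w \<longrightarrow>
      pair_inner (\<lambda>x. ut x t, \<lambda>x. Ht x t) w - pair_inner (\<lambda>x. u x t, \<lambda>x. H x t) (wave_op c w)
        = line_source_integral p \<theta> (\<lambda>xs. b xs t) (fst w)"
    using wave[unfolded wave_equation_def, folded c_def] by (elim exE conjE) (rule that, assumption+)
  note weak = weak_all[rule_format]
  let ?j = "\<lambda>t s. line_source_integral p \<theta> (\<lambda>xs. b xs t) (\<lambda>x. u x s)"
  let ?D = "data p \<theta> b T\<^sub>b u"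
  have pairing: "L2_inner (\<lambda>x. ut x t) (\<lambda>x. u x s) + L2_inner (\<lambda>x. H x t) (\<lambda>x. Ht x s) = ?j t s" for t s
  proof -
    \<comment> \<open>The time window is chosen to contain \<open>s\<close>; finite speed then
      bounds the spatial support of the wave at that time.\<close>
    obtain R where "\<And>x. x \<in> {x. \<exists>t\<in>{-\<bar>s\<bar>..\<bar>s\<bar>}. u x t \<noteq> 0 \<or> H x t \<noteq> 0} \<Longrightarrow> norm x < R"
      using finite_speed[of "\<bar>s\<bar>"] unfolding bounded_pos_less by blast
    then have supp: "u x s = 0" if "R \<le> norm x" for x
      using that by fastforce
    have "continuous_on (- \<Omega>) (\<lambda>x. (\<lambda>(x, t). u x t) (x, s))"
      by (rule continuous_on_compose2[OF u_continuous]) (auto intro!: continuous_intros)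
    then have u_cont: "continuous_on (- \<Omega>) (\<lambda>x. u x s)" by simp
    have L2: "sq_integrable (\<lambda>x. ut x t)" "sq_integrable (\<lambda>x. H x t)" "sq_integrable (\<lambda>x. u x s)"
      "sq_integrable (\<lambda>x. Ht x s)"
      using C1 by (auto simp: C1_in_time_def)
    have c_ne: "c x \<noteq> 0" for x using c_bounds(1) c_bounds(2)[of x] by linarith
    \<comment> \<open>The scalar equation is taken at time \<open>t\<close>, the field equation at
      time \<open>s\<close>.\<close>
    show ?thesis
      by (rule weak_solution_pairing[OF wave_equation_test_scalar[OF weak c_ne] wave_equation_test_field[OF weak]
          L2 supp c_meas c_bounds b_slice b_le b_antenna S u_cont c_out])
  qed
  have "source_pairing (\<lambda>t x. u x t) (\<lambda>t x. ut x t) (\<lambda>t x. H x t) (\<lambda>t x. Ht x t) ?j ?D T\<^sub>b"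
  proof
    show "?j t s = 0" if "T\<^sub>b < \<bar>t\<bar>" for t s
    proof -
      have "b xs t = 0" for xs using that by (intro b_time) auto
      then show ?thesis by (simp add: line_source_integral_def)
    qed
    show "integrable lborel (\<lambda>q. ?j q (d - q))" for d
      by (rule line_source_time_integral(1)[OF b_measurable b_le b_antenna b_time b_even u_continuous S(2)])
    show "(LINT q|lborel. ?j q (d - q)) = ?D d" for d
      by (rule line_source_time_integral(2)[OF b_measurable b_le b_antenna b_time b_even u_continuous S(2)])
  qed (use C1 pairing quiescent in \<open>auto simp: C1_in_time_L2_deriv b_even\<close>)
  then interpret source_pairing "\<lambda>t x. u x t" "\<lambda>t x. ut x t" "\<lambda>t x. H x t" "\<lambda>t x. Ht x t" ?j ?D "T\<^sub>b" .
  let ?v = "snapshot u \<tau> T"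
  have inner: "L2_inner (?v m) (?v k) = 1/2 * (?D ((real k - real m) * \<tau>) + ?D ((real m - real k) * \<tau>))
      + 1/2 * ?D (2 * T + (real m + real k) * \<tau>)" for m k
  proof -
    \<comment> \<open>Every snapshot is taken after the source has stopped; this is where
      \<open>T_large\<close> enters.\<close>
    have "T\<^sub>b < real n * \<tau> + T" for n
      using T_large tau mult_nonneg_nonneg[of "real n" \<tau>] by linarith
    from inner_eq_data[OF this this, of m k] show ?thesis
      by (simp add: snapshot_def algebra_simps)
  qed
  show ?thesis
  proof (intro conjI allI impI)
    show "transpose_mat G = G" unfolding G_def by (rule transpose_gramian)
    show "\<exists>A B. A \<in> carrier_mat M M \<and> B \<in> carrier_mat M M \<and> toeplitz A \<and> hankel B \<and> G = A + B"
      unfolding G_def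
      \<comment> \<open>The argument of \<phi> is the index difference \<open>m - j\<close>, that of
        \<psi> the index sum; in the latter the offset of both snapshot times contributes
        \<open>2 * T\<close>.\<close>
      by (rule gramian_toeplitz_hankel[where \<phi> = "\<lambda>i. 1/2 * (?D (- real_of_int i * \<tau>) + ?D (real_of_int i * \<tau>))"
            and \<psi> = "\<lambda>n. 1/2 * ?D (2 * T + real n * \<tau>)"]) (simp add: inner)
    fix m j assume mj: "m \<le> M - 1 \<and> j \<le> M - 1 - m"
    \<comment> \<open>\<open>M\<close> being at least 1 keeps the truncated subtraction
      \<open>M - 1\<close> faithful, so both indices are in range.\<close>
    then have "m < M" "m + j < M" using M by auto
    then have "G $$ (m, m + j) = L2_inner (?v m) (?v (m + j))" by (simp add: G_def gramian_def)
    also have "\<dots> = 1/2 * (?D (real j * \<tau>) + ?D (- (real j * \<tau>))) + 1/2 * ?D (2 * T + (2 * real m + real j) * \<tau>)"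
      unfolding inner by simp
    finally show "G $$ (m, m + j) = 1/2 * (?D (real j * \<tau>) + ?D (- (real j * \<tau>)))
        + 1/2 * ?D (2 * T + (2 * real m + real j) * \<tau>)" .
  qed
qed

end
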